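(* Let $\mathbb{K}$ be a field and let $\mathcal{A}$ be the Hopf algebra of simplicial complexes over $\mathbb{K}$ with antipode $S$. Let $\Gamma$ be a simplicial complex with vertex set $V=V(\Gamma)$, $|V|=n\geq 1$. Then $$S(\Gamma)=\sum_{F\in\mathcal{F}(\Gamma^{(1)})}(-1)^{c(F)}\,a(\Gamma^{(1)}/F)\,\Gamma_{V,F},$$ where the sum runs over all flats $F$ of the graph $\Gamma^{(1)}$.
   Context: A finite (abstract) simplicial complex $\Gamma$ is a collection of subsets (faces) of a finite set closed under taking subsets; $\dim X=|X|-1$ for a face $X$, $\dim\Gamma$ is the maximum dimension of a face, and $V(\Gamma)$ is the set of vertices (0-dimensional faces). For $T\subseteq V(\Gamma)$ the induced complex is $\Gamma_T=\{X\cap T: X\in\Gamma\}$. The disjoint union $\Gamma\uplus\Theta$ has vertex set $V(\Gamma)\uplus V(\Theta)$ and faces those of $\Gamma$ or of $\Theta$. $\mathcal{A}=\bigoplus_{n\ge0}A_n$, where $A_n$ is the $\mathbb{K}$-span of isomorphism classes of simplicial complexes on $n$ vertices; complexes are identified with their isomorphism classes. Product: $\Gamma\cdot\Theta=\Gamma\uplus\Theta$; unit: the empty complex $\varnothing$ (no vertices); coproduct $\Delta(\Gamma)=\sum_{T\subseteq V(\Gamma)}\Gamma_T\otimes\Gamma_{V(\Gamma)-T}$; counit $\epsilon(\Gamma)=1$ if $\Gamma=\varnothing$ and $0$ otherwise. This is a graded connected commutative and cocommutative Hopf algebra; $S$ is its antipode. The $k$-skeleton $\Gamma^{(k)}$ is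 the set of faces of $\Gamma$ of dimension at most $k$; $\Gamma^{(1)}$ is regarded as a simple graph on $V$. For a graph $G=(V,E)$, a flat is a set $F\subseteq E$ such that every connected component of the graph $(V,F)$ is an induced subgraph of $G$; $\mathcal{F}(G)$ is the set of flats and $c(F)$ is the number of connected components of $(V,F)$. $G/F$ is the graph obtained from $G$ by contracting the edges of $F$, and $a(G)$ denotes the number of acyclic orientations of $G$. For a flat $F$ of $\Gamma^{(1)}$, $\Gamma_{V,F}$ is the subcomplex of $\Gamma$ with vertex set $V$ whose faces are the faces $X\in\Gamma$ all of whose 2-element subsets lie in $F$. *)

theory Defs
  imports Complex_Main "HOL-Library.Poly_Mapping"
begin

section \<open>Simplicial complexes\<close>

text \<open>A complex is given by its set of faces. The empty set is required to be a face, so that there is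
  exactly one complex without vertices, namely \<open>{{}}\<close>, and every element of a face is a vertex.\<close>

definition simplicial_complex :: "'a set set \<Rightarrow> bool" where
  "simplicial_complex \<Gamma> \<longleftrightarrow>
     finite (\<Union>\<Gamma>) \<and> {} \<in> \<Gamma> \<and> (\<forall>X\<in>\<Gamma>. \<forall>Y. Y \<subseteq> X \<longrightarrow> Y \<in> \<Gamma>)"

definition face_dim :: "'a set \<Rightarrow> int" where
  "face_dim X = int (card X) - 1"

definition vertices :: "'a set set \<Rightarrow> 'a set" where
  "vertices \<Gamma> = {v. {v} \<in> \<Gamma>}"

definition induced_complex :: "'a set set \<Rightarrow> 'a set \<Rightarrow> 'a set set" where
  "induced_complex \<Gamma> T = {X \<inter> T |X. X \<in> \<Gamma>}"

definition disjoint_union :: "'a set set \<Rightarrow> 'b set set \<Rightarrow> ('a + 'b) set set" where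
  "disjoint_union \<Gamma> \<Theta> = (image Inl) ` \<Gamma> \<union> (image Inr) ` \<Theta>"

definition skeleton :: "nat \<Rightarrow> 'a set set \<Rightarrow> 'a set set" where
  "skeleton k \<Gamma> = {X \<in> \<Gamma>. face_dim X \<le> int k}"

definition isomorphic :: "'a set set \<Rightarrow> 'b set set \<Rightarrow> bool" where
  "isomorphic \<Gamma> \<Theta> \<longleftrightarrow>
     (\<exists>f. bij_betw f (vertices \<Gamma>) (vertices \<Theta>) \<and> \<Theta> = (image f) ` \<Gamma>)"

lemma vertices_eq_Union:
  assumes "simplicial_complex \<Gamma>"
  shows "vertices \<Gamma> = \<Union>\<Gamma>"
proof -
  have "{v} \<in> \<Gamma>" if "v \<in> X" "X \<in> \<Gamma>" for v X
    using assms that unfolding simplicial_complex_def by simp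
  then show ?thesis
    unfolding vertices_def by blast
qed

lemma finite_vertices: "simplicial_complex \<Gamma> \<Longrightarrow> finite (vertices \<Gamma>)"
  by (simp add: vertices_eq_Union) (simp add: simplicial_complex_def)

lemma face_subset_vertices: "simplicial_complex \<Gamma> \<Longrightarrow> X \<in> \<Gamma> \<Longrightarrow> X \<subseteq> vertices \<Gamma>"
  by (auto simp: vertices_eq_Union)

lemma simplicial_complex_image:
  assumes "simplicial_complex \<Gamma>"
  shows "simplicial_complex ((image f) ` \<Gamma>)"
proof -
  have "\<Union>((image f) ` \<Gamma>) = f ` (\<Union>\<Gamma>)" by blast
  moreover have "Y \<in> (image f) ` \<Gamma>" if "X \<in> \<Gamma>" "Y \<subseteq> f ` X" for X Y
    using that assms unfolding simplicial_complex_def subset_image_iff by blast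
  ultimately show ?thesis
    using assms unfolding simplicial_complex_def by auto
qed

lemma isomorphic_refl: "isomorphic \<Gamma> \<Gamma>"
  unfolding isomorphic_def by (rule exI[of _ "\<lambda>x. x"]) (auto simp: bij_betw_def)

lemma isomorphic_imageI:
  assumes "simplicial_complex \<Gamma>" "inj_on f (vertices \<Gamma>)"
  shows "isomorphic \<Gamma> ((image f) ` \<Gamma>)"
proof -
  have "vertices ((image f) ` \<Gamma>) = f ` vertices \<Gamma>"
    using assms simplicial_complex_image[OF assms(1), of f] by (auto simp: vertices_eq_Union)
  then show ?thesis
    using assms unfolding isomorphic_def bij_betw_def by blast
qed

lemma isomorphic_sym:
  assumes "simplicial_complex \<Gamma>" "isomorphic \<Gamma> \<Theta>"
  shows "isomorphic \<Theta> \<Gamma>"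
proof -
  obtain f where f: "bij_betw f (vertices \<Gamma>) (vertices \<Theta>)" "\<Theta> = (image f) ` \<Gamma>"
    using assms unfolding isomorphic_def by blast
  let ?g = "inv_into (vertices \<Gamma>) f"
  have "?g ` (f ` X) = X" if "X \<in> \<Gamma>" for X
    using f(1) face_subset_vertices[OF assms(1) that]
    by (simp add: bij_betw_def inv_into_image_cancel)
  then have "\<Gamma> = (image ?g) ` \<Theta>"
    unfolding f(2) image_image by simp
  then show ?thesis
    unfolding isomorphic_def using bij_betw_inv_into[OF f(1)] by blast
qed

lemma isomorphic_trans:
  assumes "isomorphic \<Gamma> \<Theta>" "isomorphic \<Theta> \<Lambda>"
  shows "isomorphic \<Gamma> \<Lambda>"
proof -
  obtain f where f: "bij_betw f (vertices \<Gamma>) (vertices \<Theta>)" "\<Theta> = (image f) ` \<Gamma>"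
    using assms unfolding isomorphic_def by blast
  obtain g where g: "bij_betw g (vertices \<Theta>) (vertices \<Lambda>)" "\<Lambda> = (image g) ` \<Theta>"
    using assms unfolding isomorphic_def by blast
  have "\<Lambda> = (image (g \<circ> f)) ` \<Gamma>"
    unfolding f(2) g(2) by (simp add: image_image image_comp)
  then show ?thesis
    unfolding isomorphic_def using bij_betw_trans[OF f(1) g(1)] by blast
qed

lemma isomorphic_card_vertices:
  "isomorphic \<Gamma> \<Theta> \<Longrightarrow> card (vertices \<Gamma>) = card (vertices \<Theta>)"
  unfolding isomorphic_def by (auto dest: bij_betw_same_card)

lemma simplicial_complex_isomorphic:
  "simplicial_complex \<Gamma> \<Longrightarrow> isomorphic \<Gamma> \<Theta> \<Longrightarrow> simplicial_complex \<Theta>"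
  unfolding isomorphic_def by (auto intro: simplicial_complex_image)

lemma simplicial_complex_empty: "simplicial_complex {{}}"
  unfolding simplicial_complex_def by auto

lemma simplicial_complex_induced:
  assumes "simplicial_complex \<Gamma>"
  shows "simplicial_complex (induced_complex \<Gamma> T)"
proof -
  have "\<Union>(induced_complex \<Gamma> T) \<subseteq> \<Union>\<Gamma>"
    unfolding induced_complex_def by blast
  then have "finite (\<Union>(induced_complex \<Gamma> T))"
    using assms finite_subset unfolding simplicial_complex_def by blast
  moreover have "{} \<in> induced_complex \<Gamma> T"
    using assms unfolding simplicial_complex_def induced_complex_def by blast
  moreover have "Y \<in> induced_complex \<Gamma> T" if Z: "Z \<in> induced_complex \<Gamma> T" "Y \<subseteq> Z" for Y Z
  proof -
    obtain X where X: "X \<in> \<Gamma>" "Z = X \<inter> T"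
      using Z(1) unfolding induced_complex_def by auto
    then have "Y \<subseteq> X" "Y = Y \<inter> T"
      using Z(2) by auto
    moreover from this X have "Y \<in> \<Gamma>"
      using assms unfolding simplicial_complex_def by simp
    ultimately show ?thesis unfolding induced_complex_def by blast
  qed
  ultimately show ?thesis
    unfolding simplicial_complex_def by simp
qed

lemma vertices_induced:
  assumes "simplicial_complex \<Gamma>"
  shows "vertices (induced_complex \<Gamma> T) = vertices \<Gamma> \<inter> T"
  using assms simplicial_complex_induced[OF assms]
  by (auto simp: vertices_eq_Union induced_complex_def)

lemma simplicial_complex_disjoint_union:
  assumes "simplicial_complex \<Gamma>" "simplicial_complex \<Theta>"
  shows "simplicial_complex (disjoint_union \<Gamma> \<Theta>)"
proof -
  have "simplicial_complex (\<Lambda> \<union> \<Lambda>')"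
    if "simplicial_complex \<Lambda>" "simplicial_complex \<Lambda>'" for \<Lambda> \<Lambda>' :: "('a + 'b) set set"
    using that unfolding simplicial_complex_def by (auto simp: ball_Un)
  then show ?thesis
    unfolding disjoint_union_def
    using simplicial_complex_image[OF assms(1), of Inl]
      simplicial_complex_image[OF assms(2), of Inr] by blast
qed

lemma vertices_disjoint_union:
  assumes "simplicial_complex \<Gamma>" "simplicial_complex \<Theta>"
  shows "vertices (disjoint_union \<Gamma> \<Theta>) = vertices \<Gamma> <+> vertices \<Theta>"
  using assms simplicial_complex_disjoint_union[OF assms]
  by (auto simp: vertices_eq_Union disjoint_union_def Plus_def)

lemma isomorphic_disjoint_union:
  assumes "simplicial_complex \<Gamma>" "simplicial_complex \<Theta>"
    and "isomorphic \<Gamma> \<Gamma>'" "isomorphic \<Theta> \<Theta>'"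
  shows "isomorphic (disjoint_union \<Gamma> \<Theta>) (disjoint_union \<Gamma>' \<Theta>')"
proof -
  obtain f where f: "bij_betw f (vertices \<Gamma>) (vertices \<Gamma>')" "\<Gamma>' = (image f) ` \<Gamma>"
    using assms unfolding isomorphic_def by blast
  obtain g where g: "bij_betw g (vertices \<Theta>) (vertices \<Theta>')" "\<Theta>' = (image g) ` \<Theta>"
    using assms unfolding isomorphic_def by blast
  have "inj_on (map_sum f g) (vertices \<Gamma> <+> vertices \<Theta>)"
  proof (rule inj_onI)
    fix x y
    assume "x \<in> vertices \<Gamma> <+> vertices \<Theta>" "y \<in> vertices \<Gamma> <+> vertices \<Theta>"
      and "map_sum f g x = map_sum f g y"
    then show "x = y"
      using inj_onD[OF bij_betw_imp_inj_on[OF f(1)]] inj_onD[OF bij_betw_imp_inj_on[OF g(1)]]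
      by (cases x; cases y) auto
  qed
  moreover have "disjoint_union \<Gamma>' \<Theta>' = (image (map_sum f g)) ` disjoint_union \<Gamma> \<Theta>"
    unfolding disjoint_union_def f(2) g(2) by (simp add: image_Un image_image)
  ultimately show ?thesis
    using isomorphic_imageI[of "disjoint_union \<Gamma> \<Theta>" "map_sum f g"]
      simplicial_complex_disjoint_union vertices_disjoint_union assms by metis
qed

lemma isomorphic_disjoint_union_commute:
  assumes "simplicial_complex \<Gamma>" "simplicial_complex \<Theta>"
  shows "isomorphic (disjoint_union \<Gamma> \<Theta>) (disjoint_union \<Theta> \<Gamma>)"
proof -
  let ?s = "case_sum Inr Inl"
  have "inj_on ?s (vertices (disjoint_union \<Gamma> \<Theta>))"
    by (auto simp: inj_on_def split: sum.splits)
  moreover have "disjoint_union \<Theta> \<Gamma> = (image ?s) ` disjoint_union \<Gamma> \<Theta>"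
    unfolding disjoint_union_def by (simp add: image_Un image_image Un_commute)
  ultimately show ?thesis
    using isomorphic_imageI simplicial_complex_disjoint_union[OF assms] by metis
qed

lemma isomorphic_disjoint_union_assoc:
  assumes "simplicial_complex \<Gamma>" "simplicial_complex \<Theta>" "simplicial_complex \<Lambda>"
  shows "isomorphic (disjoint_union (disjoint_union \<Gamma> \<Theta>) \<Lambda>)
    (disjoint_union \<Gamma> (disjoint_union \<Theta> \<Lambda>))"
proof -
  let ?s = "case_sum (case_sum Inl (Inr \<circ> Inl)) (Inr \<circ> Inr)"
  have "inj_on ?s (vertices (disjoint_union (disjoint_union \<Gamma> \<Theta>) \<Lambda>))"
    by (auto simp: inj_on_def split: sum.splits)
  moreover have "disjoint_union \<Gamma> (disjoint_union \<Theta> \<Lambda>)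
      = (image ?s) ` disjoint_union (disjoint_union \<Gamma> \<Theta>) \<Lambda>"
    unfolding disjoint_union_def by (simp add: image_Un image_image Un_assoc)
  ultimately show ?thesis
    using isomorphic_imageI simplicial_complex_disjoint_union assms by metis
qed

lemma isomorphic_disjoint_union_empty:
  assumes "simplicial_complex \<Gamma>"
  shows "isomorphic \<Gamma> (disjoint_union {{} :: 'b set} \<Gamma>)"
proof -
  have "disjoint_union {{} :: 'b set} \<Gamma> = (image Inr) ` \<Gamma>"
    using assms unfolding disjoint_union_def simplicial_complex_def by auto
  then show ?thesis
    using isomorphic_imageI[OF assms, of "Inr :: _ \<Rightarrow> 'b + _"] by simp
qed

lemma isomorphic_induced:
  assumes "simplicial_complex \<Gamma>" "bij_betw f (vertices \<Gamma>) (vertices \<Theta>)" "\<Theta> = (image f) ` \<Gamma>"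
    and "T \<subseteq> vertices \<Gamma>"
  shows "isomorphic (induced_complex \<Gamma> T) (induced_complex \<Theta> (f ` T))"
proof -
  have "f ` (X \<inter> T) = f ` X \<inter> f ` T" if "X \<in> \<Gamma>" for X
    using assms(2,4) face_subset_vertices[OF assms(1) that]
    by (metis bij_betw_def inj_on_image_Int)
  then have "induced_complex \<Theta> (f ` T) = (image f) ` induced_complex \<Gamma> T"
    unfolding induced_complex_def assms(3) Setcompr_eq_image image_image by simp
  moreover have "inj_on f (vertices (induced_complex \<Gamma> T))"
    using assms by (auto simp: vertices_induced bij_betw_def inj_on_def)
  ultimately show ?thesis
    using isomorphic_imageI simplicial_complex_induced[OF assms(1)] by metis
qed


section \<open>Isomorphism classes\<close>

text \<open>Every finite complex is isomorphic to one whose vertices are natural numbers, so the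
  isomorphism classes of complexes on \<open>nat\<close> are the isomorphism classes of all complexes;
  \<open>iso_class\<close> sends a complex over an arbitrary vertex type to its class.\<close>

quotient_type complex_class = "nat set set" / partial:
  "\<lambda>\<Gamma> \<Theta>. simplicial_complex \<Gamma> \<and> simplicial_complex \<Theta> \<and> isomorphic \<Gamma> \<Theta>"
proof (rule part_equivpI)
  show "\<exists>\<Gamma>::nat set set. simplicial_complex \<Gamma> \<and> simplicial_complex \<Gamma> \<and> isomorphic \<Gamma> \<Gamma>"
    using simplicial_complex_empty isomorphic_refl by blast
qed (auto intro!: sympI transpI intro: isomorphic_sym isomorphic_trans)

definition iso_class :: "'a set set \<Rightarrow> complex_class" where
  "iso_class \<Gamma> = abs_complex_class (SOME \<Theta>. simplicial_complex \<Theta> \<and> isomorphic \<Gamma> \<Theta>)"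

lemma ex_nat_complex:
  assumes "simplicial_complex \<Gamma>"
  shows "\<exists>\<Theta>::nat set set. simplicial_complex \<Theta> \<and> isomorphic \<Gamma> \<Theta>"
proof -
  obtain f :: "'a \<Rightarrow> nat" where "inj_on f (vertices \<Gamma>)"
    using finite_vertices[OF assms] finite_imp_inj_to_nat_seg by metis
  then show ?thesis
    using isomorphic_imageI[OF assms] simplicial_complex_image[OF assms] by blast
qed

lemma iso_class_eq_iff:
  assumes "simplicial_complex \<Gamma>" "simplicial_complex \<Theta>"
  shows "iso_class \<Gamma> = iso_class \<Theta> \<longleftrightarrow> isomorphic \<Gamma> \<Theta>"
proof -
  define G where "G = (SOME \<Lambda>::nat set set. simplicial_complex \<Lambda> \<and> isomorphic \<Gamma> \<Lambda>)"
  define H where "H = (SOME \<Lambda>::nat set set. simplicial_complex \<Lambda> \<and> isomorphic \<Theta> \<Lambda>)"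
  have G: "simplicial_complex G" "isomorphic \<Gamma> G"
    using someI_ex[OF ex_nat_complex[OF assms(1)]] unfolding G_def by auto
  have H: "simplicial_complex H" "isomorphic \<Theta> H"
    using someI_ex[OF ex_nat_complex[OF assms(2)]] unfolding H_def by auto
  have "iso_class \<Gamma> = iso_class \<Theta> \<longleftrightarrow> isomorphic G H"
    unfolding iso_class_def G_def[symmetric] H_def[symmetric]
    using Quotient_rel[OF Quotient_complex_class, of G H] G H isomorphic_refl by blast
  also have "\<dots> \<longleftrightarrow> isomorphic \<Gamma> \<Theta>"
    using G H assms isomorphic_trans isomorphic_sym by metis
  finally show ?thesis .
qed

lemma iso_class_rep:
  "simplicial_complex (rep_complex_class c)" "iso_class (rep_complex_class c) = c"
proof -
  have *: "simplicial_complex (rep_complex_class c)"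
    using Quotient_rep_reflp[OF Quotient_complex_class] by blast
  then show "simplicial_complex (rep_complex_class c)" .
  define G where "G = (SOME \<Lambda>::nat set set. simplicial_complex \<Lambda> \<and> isomorphic (rep_complex_class c) \<Lambda>)"
  have G: "simplicial_complex G" "isomorphic (rep_complex_class c) G"
    using someI_ex[OF ex_nat_complex[OF *]] unfolding G_def by auto
  then have "abs_complex_class G = abs_complex_class (rep_complex_class c)"
    using Quotient_rel[OF Quotient_complex_class, of "rep_complex_class c" G] * isomorphic_refl
    by metis
  then show "iso_class (rep_complex_class c) = c"
    unfolding iso_class_def G_def[symmetric]
    by (simp add: Quotient_abs_rep[OF Quotient_complex_class])
qed

lemma isomorphic_rep_iso_class:
  "simplicial_complex \<Gamma> \<Longrightarrow> isomorphic \<Gamma> (rep_complex_class (iso_class \<Gamma>))"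
  using iso_class_eq_iff iso_class_rep by metis

text \<open>The classes form a commutative monoid under disjoint union, written additively: the product of
  \<open>complex_class \<Rightarrow>\<^sub>0 'k\<close> provided by \<open>Poly_Mapping\<close> is then the monoid algebra product, that is,
  the bilinear extension of disjoint union, and its unit is the class of the empty complex.\<close>

instantiation complex_class :: comm_monoid_add
begin

definition zero_complex_class :: complex_class where
  "zero_complex_class = iso_class {{} :: nat set}"

definition plus_complex_class :: "complex_class \<Rightarrow> complex_class \<Rightarrow> complex_class" where
  "plus_complex_class c d = iso_class (disjoint_union (rep_complex_class c) (rep_complex_class d))"

lemma iso_class_disjoint_union:
  assumes "simplicial_complex \<Gamma>" "simplicial_complex \<Theta>"
  shows "iso_class (disjoint_union \<Gamma> \<Theta>) = iso_class \<Gamma> + iso_class \<Theta>"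
  unfolding plus_complex_class_def
  by (intro iso_class_eq_iff[THEN iffD2] simplicial_complex_disjoint_union
      isomorphic_disjoint_union isomorphic_rep_iso_class iso_class_rep assms)

instance
proof
  fix a b c :: complex_class
  let ?r = rep_complex_class
  have *: "\<exists>\<Gamma>::nat set set. simplicial_complex \<Gamma> \<and> x = iso_class \<Gamma>" for x
    using iso_class_rep by metis
  obtain \<Gamma> \<Theta> \<Lambda> :: "nat set set"
    where s: "simplicial_complex \<Gamma>" "simplicial_complex \<Theta>" "simplicial_complex \<Lambda>"
      and e: "a = iso_class \<Gamma>" "b = iso_class \<Theta>" "c = iso_class \<Lambda>"
    using *[of a] *[of b] *[of c] by blast
  show "a + b + c = a + (b + c)"
    unfolding e using s
    by (simp add: iso_class_disjoint_union[symmetric] simplicial_complex_disjoint_union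
        iso_class_eq_iff isomorphic_disjoint_union_assoc)
  show "a + b = b + a"
    unfolding e using s
    by (simp add: iso_class_disjoint_union[symmetric] simplicial_complex_disjoint_union
        iso_class_eq_iff isomorphic_disjoint_union_commute)
  show "0 + a = a"
    unfolding e zero_complex_class_def using s
    by (metis iso_class_disjoint_union simplicial_complex_disjoint_union
        iso_class_eq_iff isomorphic_disjoint_union_empty simplicial_complex_empty)
qed

end


section \<open>The Hopf algebra of simplicial complexes\<close>

text \<open>The vector space with basis \<open>'b\<close> over \<open>'k\<close> is \<open>'b \<Rightarrow>\<^sub>0 'k\<close>. The tensor square of
  \<open>'k complex_algebra\<close> is represented on its basis of pure tensors of classes.\<close>

type_synonym 'k complex_algebra = "complex_class \<Rightarrow>\<^sub>0 'k"

type_synonym 'k complex_algebra_square = "(complex_class \<times> complex_class) \<Rightarrow>\<^sub>0 'k"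

definition scale :: "'k::field \<Rightarrow> ('b \<Rightarrow>\<^sub>0 'k) \<Rightarrow> ('b \<Rightarrow>\<^sub>0 'k)" where
  "scale a p = Poly_Mapping.map ((*) a) p"

definition linear_extension :: "('b \<Rightarrow> ('c \<Rightarrow>\<^sub>0 'k)) \<Rightarrow> ('b \<Rightarrow>\<^sub>0 'k::field) \<Rightarrow> ('c \<Rightarrow>\<^sub>0 'k)" where
  "linear_extension f p =
     (\<Sum>b\<in>Poly_Mapping.keys p. scale (Poly_Mapping.lookup p b) (f b))"

definition basis_element :: "'a set set \<Rightarrow> 'k::field complex_algebra" where
  "basis_element \<Gamma> = Poly_Mapping.single (iso_class \<Gamma>) 1"

definition unit_map :: "'k::field \<Rightarrow> 'k complex_algebra" where
  "unit_map a = scale a 1"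

definition counit :: "'k::field complex_algebra \<Rightarrow> 'k" where
  "counit p = Poly_Mapping.lookup p 0"

definition coproduct_of_complex :: "'a set set \<Rightarrow> 'k::field complex_algebra_square" where
  "coproduct_of_complex \<Gamma> =
     (\<Sum>T\<in>Pow (vertices \<Gamma>). Poly_Mapping.single
        (iso_class (induced_complex \<Gamma> T), iso_class (induced_complex \<Gamma> (vertices \<Gamma> - T))) 1)"

definition coproduct :: "'k::field complex_algebra \<Rightarrow> 'k complex_algebra_square" where
  "coproduct = linear_extension (\<lambda>c. coproduct_of_complex (rep_complex_class c))"

text \<open>The convolution \<open>f \<star> g = m \<circ> (f \<otimes> g) \<circ> \<Delta>\<close> of linear maps.\<close>

definition convolution ::
  "('k complex_algebra \<Rightarrow> 'k complex_algebra) \<Rightarrow> ('k complex_algebra \<Rightarrow> 'k complex_algebra)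
    \<Rightarrow> 'k::field complex_algebra \<Rightarrow> 'k complex_algebra" where
  "convolution f g p =
     linear_extension (\<lambda>(c, d). f (Poly_Mapping.single c 1) * g (Poly_Mapping.single d 1))
       (coproduct p)"

definition is_antipode :: "('k::field complex_algebra \<Rightarrow> 'k complex_algebra) \<Rightarrow> bool" where
  "is_antipode S \<longleftrightarrow> Vector_Spaces.linear scale scale S \<and>
     convolution S id = unit_map \<circ> counit \<and> convolution id S = unit_map \<circ> counit"

definition antipode :: "'k::field complex_algebra \<Rightarrow> 'k complex_algebra" where
  "antipode = (THE S. is_antipode S)"

lemma lookup_scale [simp]: "Poly_Mapping.lookup (scale a p) b = a * Poly_Mapping.lookup p b"
  unfolding scale_def by transfer (simp add: when_def)

lemma scale_single [simp]: "scale a (Poly_Mapping.single b x) = Poly_Mapping.single b (a * x)"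
  by (rule poly_mapping_eqI) (simp add: lookup_single when_def)

lemma vector_space_scale: "vector_space (scale :: 'k::field \<Rightarrow> ('b \<Rightarrow>\<^sub>0 'k) \<Rightarrow> _)"
  by unfold_locales (auto intro!: poly_mapping_eqI simp: lookup_add algebra_simps)

interpretation scale: vector_space "scale :: 'k::field \<Rightarrow> ('b \<Rightarrow>\<^sub>0 'k) \<Rightarrow> _"
  by (rule vector_space_scale)

lemma linear_extension_superset:
  assumes "finite A" "Poly_Mapping.keys p \<subseteq> A"
  shows "linear_extension f p = (\<Sum>b\<in>A. scale (Poly_Mapping.lookup p b) (f b))"
  unfolding linear_extension_def
  by (rule sum.mono_neutral_left) (use assms in \<open>auto simp: in_keys_iff\<close>)

lemma linear_extension_single [simp]:
  "linear_extension f (Poly_Mapping.single b a) = scale a (f b)"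
  by (subst linear_extension_superset[of "{b}"]) auto

lemma linear_linear_extension:
  fixes f :: "'b \<Rightarrow> ('c \<Rightarrow>\<^sub>0 'k::field)"
  shows "Vector_Spaces.linear scale scale (linear_extension f)"
proof (rule linear_module_homI, unfold_locales)
  fix p q :: "'b \<Rightarrow>\<^sub>0 'k" and a :: 'k
  let ?A = "Poly_Mapping.keys p \<union> Poly_Mapping.keys q"
  have "finite ?A" by simp
  moreover have "Poly_Mapping.keys (p + q) \<subseteq> ?A" "Poly_Mapping.keys (scale a p) \<subseteq> ?A"
    using keys_add by (auto simp: in_keys_iff lookup_add)
  ultimately show "linear_extension f (p + q) = linear_extension f p + linear_extension f q"
    and "linear_extension f (scale a p) = scale a (linear_extension f p)"
    by (simp_all add: linear_extension_superset[of ?A] lookup_add scale.scale_left_distrib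
        sum.distrib scale.scale_sum_right)
qed

lemma coproduct_of_complex_isomorphic:
  assumes "simplicial_complex \<Gamma>" "isomorphic \<Gamma> \<Theta>"
  shows "coproduct_of_complex \<Gamma> = coproduct_of_complex \<Theta>"
proof -
  obtain f where f: "bij_betw f (vertices \<Gamma>) (vertices \<Theta>)" "\<Theta> = (image f) ` \<Gamma>"
    using assms unfolding isomorphic_def by blast
  have s: "simplicial_complex \<Theta>"
    using assms by (rule simplicial_complex_isomorphic)
  have c: "iso_class (induced_complex \<Gamma> T) = iso_class (induced_complex \<Theta> (f ` T))"
    if "T \<subseteq> vertices \<Gamma>" for T
    using isomorphic_induced[OF assms(1) f that] s assms(1)
    by (simp add: iso_class_eq_iff simplicial_complex_induced)
  have d: "vertices \<Theta> - f ` T = f ` (vertices \<Gamma> - T)" if "T \<subseteq> vertices \<Gamma>" for T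
    using f(1) that by (metis bij_betw_def inj_on_image_set_diff Diff_subset)
  show ?thesis
    unfolding coproduct_of_complex_def
    by (subst sum.reindex_bij_betw[OF bij_betw_Pow[OF f(1)], symmetric])
       (auto intro!: sum.cong simp: c d)
qed

lemma coproduct_basis_element:
  assumes "simplicial_complex \<Gamma>"
  shows "coproduct (basis_element \<Gamma>) = coproduct_of_complex \<Gamma>"
  unfolding coproduct_def basis_element_def
  by (simp add: coproduct_of_complex_isomorphic[OF assms isomorphic_rep_iso_class[OF assms],
        symmetric])

lemma mult_basis_element:
  assumes "simplicial_complex \<Gamma>" "simplicial_complex \<Theta>"
  shows "basis_element \<Gamma> * basis_element \<Theta> = basis_element (disjoint_union \<Gamma> \<Theta>)"
  using assms by (simp add: basis_element_def mult_single iso_class_disjoint_union)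

lemma counit_basis_element:
  assumes "simplicial_complex \<Gamma>"
  shows "counit (basis_element \<Gamma>) = (if vertices \<Gamma> = {} then 1 else 0)"
proof -
  have "\<Gamma> = {{}}" if "vertices \<Gamma> = {}"
    using that face_subset_vertices[OF assms] assms unfolding simplicial_complex_def by auto
  moreover have "iso_class \<Gamma> = 0 \<longleftrightarrow> isomorphic \<Gamma> {{} :: nat set}"
    unfolding zero_complex_class_def by (rule iso_class_eq_iff[OF assms simplicial_complex_empty])
  moreover have "vertices {{} :: nat set} = {}" "isomorphic {{} :: 'a set} {{} :: nat set}"
    unfolding isomorphic_def vertices_def by (auto simp: bij_betw_def)
  ultimately show ?thesis
    unfolding counit_def basis_element_def lookup_single when_def isomorphic_def
    by (metis bij_betw_empty2)
qed


lemma linear_eq_linear_extension: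
  fixes f :: "('b \<Rightarrow>\<^sub>0 'k::field) \<Rightarrow> ('c \<Rightarrow>\<^sub>0 'k)"
  assumes "Vector_Spaces.linear scale scale f"
  shows "f = linear_extension (\<lambda>b. f (Poly_Mapping.single b 1))"
proof
  fix p :: "'b \<Rightarrow>\<^sub>0 'k"
  interpret f: Vector_Spaces.linear scale scale f by fact
  have "p = (\<Sum>b\<in>Poly_Mapping.keys p. scale (Poly_Mapping.lookup p b) (Poly_Mapping.single b 1))"
    by (rule poly_mapping_eqI)
       (simp add: lookup_sum lookup_single when_def in_keys_iff)
  then have "f p = f (\<Sum>b\<in>Poly_Mapping.keys p. scale (Poly_Mapping.lookup p b) (Poly_Mapping.single b 1))"
    by (rule arg_cong)
  then show "f p = linear_extension (\<lambda>b. f (Poly_Mapping.single b 1)) p"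
    by (simp only: f.sum f.scale linear_extension_def)
qed

lemma linear_eqI:
  assumes "Vector_Spaces.linear scale scale f" "Vector_Spaces.linear scale scale g"
    and "\<And>b. f (Poly_Mapping.single b 1) = g (Poly_Mapping.single b 1)"
  shows "f = g"
  by (subst linear_eq_linear_extension[OF assms(1)], subst linear_eq_linear_extension[OF assms(2)])
     (simp add: assms(3))

lemma linear_convolution:
  "Vector_Spaces.linear scale scale (convolution f g)"
proof -
  have "convolution f g = linear_extension
      (\<lambda>(c, d). f (Poly_Mapping.single c 1) * g (Poly_Mapping.single d 1)) \<circ> coproduct"
    by (simp add: fun_eq_iff convolution_def)
  then show ?thesis
    unfolding coproduct_def
    by (simp only: Vector_Spaces.linear_compose[OF linear_linear_extension linear_linear_extension])
qed

lemma basis_element_rep: "basis_element (rep_complex_class c) = Poly_Mapping.single c 1"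
  by (simp add: basis_element_def iso_class_rep)

lemma convolution_basis_element:
  assumes "simplicial_complex \<Gamma>"
  shows "convolution f g (basis_element \<Gamma>) =
    (\<Sum>T\<in>Pow (vertices \<Gamma>). f (basis_element (induced_complex \<Gamma> T)) *
       g (basis_element (induced_complex \<Gamma> (vertices \<Gamma> - T))))"
proof -
  let ?h = "\<lambda>(c, d). f (Poly_Mapping.single c 1) * g (Poly_Mapping.single d 1)"
  interpret h: Vector_Spaces.linear scale scale "linear_extension ?h"
    by (rule linear_linear_extension)
  show ?thesis
    unfolding convolution_def coproduct_basis_element[OF assms] coproduct_of_complex_def h.sum
    by (simp add: basis_element_def)
qed

lemma convolution_commute: "convolution f g = convolution g f"
proof (rule linear_eqI[OF linear_convolution linear_convolution])
  fix c
  let ?\<Gamma> = "rep_complex_class c"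
  let ?V = "vertices ?\<Gamma>"
  have "bij_betw (\<lambda>T. ?V - T) (Pow ?V) (Pow ?V)"
    by (rule bij_betw_byWitness[where f' = "\<lambda>T. ?V - T"]) auto
  then show "convolution f g (Poly_Mapping.single c 1) = convolution g f (Poly_Mapping.single c 1)"
    unfolding basis_element_rep[symmetric] convolution_basis_element[OF iso_class_rep(1)]
    by (subst sum.reindex_bij_betw[symmetric])
       (auto intro!: sum.cong simp: double_diff mult.commute)
qed

lemma induced_vertices: "simplicial_complex \<Gamma> \<Longrightarrow> induced_complex \<Gamma> (vertices \<Gamma>) = \<Gamma>"
  unfolding induced_complex_def using face_subset_vertices[of \<Gamma>] by (auto simp: Int_absorb2)

lemma basis_element_induced_empty:
  assumes "simplicial_complex \<Gamma>"
  shows "basis_element (induced_complex \<Gamma> {}) = 1"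
proof -
  have "isomorphic {{} :: 'a set} {{} :: nat set}"
    unfolding isomorphic_def vertices_def by (auto simp: bij_betw_def)
  moreover have "induced_complex \<Gamma> {} = {{}}"
    using assms by (auto simp: induced_complex_def simplicial_complex_def)
  ultimately have "iso_class (induced_complex \<Gamma> {}) = 0"
    unfolding zero_complex_class_def by (simp add: iso_class_eq_iff simplicial_complex_empty)
  then show ?thesis
    unfolding basis_element_def by simp
qed

lemma convolution_id_basis_element:
  assumes "simplicial_complex \<Gamma>"
  shows "convolution S id (basis_element \<Gamma>) = S (basis_element \<Gamma>) +
    (\<Sum>T\<in>Pow (vertices \<Gamma>) - {vertices \<Gamma>}. S (basis_element (induced_complex \<Gamma> T)) *
       basis_element (induced_complex \<Gamma> (vertices \<Gamma> - T)))"
  unfolding convolution_basis_element[OF assms]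
  by (subst sum.remove[of _ "vertices \<Gamma>"])
     (use assms in \<open>simp_all add: finite_vertices induced_vertices basis_element_induced_empty\<close>)

definition class_size :: "complex_class \<Rightarrow> nat" where
  "class_size c = card (vertices (rep_complex_class c))"

lemma class_size_induced:
  assumes "simplicial_complex \<Gamma>" "T \<subset> vertices \<Gamma>"
  shows "class_size (iso_class (induced_complex \<Gamma> T)) < card (vertices \<Gamma>)"
proof -
  have "class_size (iso_class (induced_complex \<Gamma> T)) = card (vertices (induced_complex \<Gamma> T))"
    unfolding class_size_def
    using isomorphic_rep_iso_class[OF simplicial_complex_induced[OF assms(1)]]
    by (metis isomorphic_card_vertices)
  also have "\<dots> < card (vertices \<Gamma>)"
    using assms by (simp add: vertices_induced finite_vertices psubset_card_mono Int_absorb1 psubset_imp_subset)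
  finally show ?thesis .
qed

function antipode_of_class :: "complex_class \<Rightarrow> 'k::field complex_algebra" where
  "antipode_of_class c = unit_map (counit (Poly_Mapping.single c 1)) -
     (let \<Gamma> = rep_complex_class c in
       \<Sum>T\<in>Pow (vertices \<Gamma>) - {vertices \<Gamma>}. antipode_of_class (iso_class (induced_complex \<Gamma> T)) *
         basis_element (induced_complex \<Gamma> (vertices \<Gamma> - T)))"
  by auto
termination
proof (relation "measure class_size")
  fix c \<Gamma> and T :: "nat set"
  assume "\<Gamma> = rep_complex_class c" "T \<in> Pow (vertices \<Gamma>) - {vertices \<Gamma>}"
  then show "(iso_class (induced_complex \<Gamma> T), c) \<in> measure class_size"
    using class_size_induced[of "rep_complex_class c" T] iso_class_rep(1)[of c]
    by (auto simp: class_size_def[of c])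
qed simp

declare antipode_of_class.simps [simp del]

lemma linear_unit_counit: "Vector_Spaces.linear scale scale (unit_map \<circ> counit)"
  by (rule linear_module_homI, unfold_locales)
     (auto intro!: poly_mapping_eqI simp: unit_map_def counit_def lookup_add algebra_simps)

text \<open>The antipode exists and is unique, so \<open>antipode\<close> denotes it.\<close>

theorem ex1_antipode: "\<exists>!S :: 'k::field complex_algebra \<Rightarrow> 'k complex_algebra. is_antipode S"
proof (rule ex_ex1I)
  let ?S = "linear_extension antipode_of_class :: 'k complex_algebra \<Rightarrow> 'k complex_algebra"
  have "convolution ?S id = unit_map \<circ> counit"
  proof (rule linear_eqI[OF linear_convolution linear_unit_counit])
    fix c
    show "convolution ?S id (Poly_Mapping.single c 1) = (unit_map \<circ> counit) (Poly_Mapping.single c 1)"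
      unfolding basis_element_rep[symmetric] convolution_id_basis_element[OF iso_class_rep(1)]
      unfolding basis_element_rep
      by (simp add: antipode_of_class.simps[of c] Let_def) (simp add: basis_element_def)
  qed
  then show "\<exists>S :: 'k complex_algebra \<Rightarrow> 'k complex_algebra. is_antipode S"
    unfolding is_antipode_def using linear_linear_extension convolution_commute by metis
next
  fix S S' :: "'k complex_algebra \<Rightarrow> 'k complex_algebra"
  assume S: "is_antipode S" and S': "is_antipode S'"
  show "S = S'"
  proof (rule linear_eqI)
    show "S (Poly_Mapping.single c 1) = S' (Poly_Mapping.single c 1)" for c
    proof (induction c rule: measure_induct_rule[of class_size])
      case (less c)
      let ?\<Gamma> = "rep_complex_class c"
      have eq: "S (basis_element (induced_complex ?\<Gamma> T)) = S' (basis_element (induced_complex ?\<Gamma> T))"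
        if "T \<in> Pow (vertices ?\<Gamma>) - {vertices ?\<Gamma>}" for T
        unfolding basis_element_def
        by (rule less) (use that class_size_induced[OF iso_class_rep(1), of T c]
            in \<open>auto simp: class_size_def[of c]\<close>)
      have "convolution S id (basis_element ?\<Gamma>) = convolution S' id (basis_element ?\<Gamma>)"
        using S S' by (simp add: is_antipode_def)
      then have "S (basis_element ?\<Gamma>) = S' (basis_element ?\<Gamma>)"
        unfolding convolution_id_basis_element[OF iso_class_rep(1)] using eq by simp
      then show ?case
        unfolding basis_element_rep .
    qed
  qed (use S S' in \<open>auto simp: is_antipode_def\<close>)
qed

lemma is_antipode_antipode: "is_antipode antipode"
  unfolding antipode_def using ex1_antipode by (rule theI')


section \<open>Graphs and flats\<close>

text \<open>A graph is a pair of a vertex set and a set of edges. An edge is the set of its end points; a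
  singleton edge is a loop.\<close>

type_synonym 'a graph = "'a set \<times> 'a set set"

definition one_skeleton_graph :: "'a set set \<Rightarrow> 'a graph" where
  "one_skeleton_graph \<Gamma> = (vertices \<Gamma>, {e \<in> skeleton 1 \<Gamma>. face_dim e = 1})"

definition connected_components :: "'a graph \<Rightarrow> 'a set set" where
  "connected_components G = fst G // {(u, v) \<in> fst G \<times> fst G. (u, v) \<in> {(x, y). {x, y} \<in> snd G}\<^sup>*}"

definition induced_subgraph :: "'a graph \<Rightarrow> 'a set \<Rightarrow> 'a graph" where
  "induced_subgraph G C = (C, {e \<in> snd G. e \<subseteq> C})"

text \<open>For a connected component of a graph, \<open>induced_subgraph\<close> of that graph gives the
  component with its edges.\<close>

definition flats :: "'a graph \<Rightarrow> 'a set set set" where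
  "flats G = {F. F \<subseteq> snd G \<and> (\<forall>C \<in> connected_components (fst G, F).
     induced_subgraph (fst G, F) C = induced_subgraph G C)}"

text \<open>The vertices of \<open>G/F\<close> are the components of \<open>(V, F)\<close>, and an edge outside \<open>F\<close> joins the
  components of its end points. Parallel edges are merged, which does not affect the number of
  acyclic orientations; loops, which do not arise when \<open>F\<close> is a flat, are kept.\<close>

definition contract :: "'a graph \<Rightarrow> 'a set set \<Rightarrow> 'a set graph" where
  "contract G F =
     (let \<K> = connected_components (fst G, F)
      in (\<K>, {{C \<in> \<K>. C \<inter> e \<noteq> {}} |e. e \<in> snd G - F}))"

text \<open>An orientation chooses exactly one of the arcs \<open>(u, v)\<close>, \<open>(v, u)\<close> for every edge \<open>{u, v}\<close>.\<close>

definition orientations :: "'a graph \<Rightarrow> ('a \<times> 'a) set set" where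
  "orientations G = {D. (\<forall>(u, v) \<in> D. {u, v} \<in> snd G) \<and>
     (\<forall>e \<in> snd G. \<exists>!a. a \<in> D \<and> {fst a, snd a} = e)}"

definition num_acyclic_orientations :: "'a graph \<Rightarrow> nat" where
  "num_acyclic_orientations G = card {D \<in> orientations G. acyclic D}"

definition flat_subcomplex :: "'a set set \<Rightarrow> 'a set set \<Rightarrow> 'a set set" where
  "flat_subcomplex \<Gamma> F = {X \<in> \<Gamma>. \<forall>e. e \<subseteq> X \<and> card e = 2 \<longrightarrow> e \<in> F}"

end

theory Submission
  imports Defs
begin

text \<open>Write \<open>R(\<Gamma>)\<close> for the right-hand side. Since \<open>S \<star> id = unit \<circ> counit\<close> determines \<open>S\<close> recursively,
  it suffices that \<open>\<Sum>T. R(\<Gamma>\<^sub>T) \<cdot> \<Gamma>\<^bsub>V - T\<^esub> = 0\<close> for \<open>V \<noteq> {}\<close>. A flat \<open>F\<^sub>0\<close> of \<open>G[T]\<close> together with all edges of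
  \<open>G[V - T]\<close> is a flat \<open>F\<close> of \<open>G\<close>, and the coefficient collected at \<open>F\<close> is, up to sign, the sum of
  \<open>(-1)\<^bsup>|U|\<^esup> a(G/F - U)\<close> over the independent sets \<open>U\<close> of \<open>G/F\<close>. Orienting all edges at \<open>U\<close> away
  from \<open>U\<close> turns \<open>a(G/F - U)\<close> into the number of acyclic orientations of \<open>G/F\<close> in which every vertex of
  \<open>U\<close> is a source. Every acyclic orientation has a source, so the alternating sum over the
  sets \<open>U\<close> of sources of a fixed orientation vanishes.\<close>

section \<open>Acyclic orientations and sources\<close>

text \<open>Expand the product of the factors \<open>1 - 1\<close> over \<open>A\<close>; since
  \<open>A\<close> is nonempty, this product is \<open>0\<close>.\<close>

lemma sum_neg_one_power_card_Pow:
  assumes "finite A" "A \<noteq> {}"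
  shows "(\<Sum>B\<in>Pow A. (- 1) ^ card B) = (0 :: 'b::comm_ring_1)"
  using prod_diff_conv_sum[OF assms(1), of "\<lambda>_. 1" "\<lambda>_. 1 :: 'b"] assms by (simp add: power_0_left)

text \<open>No arc of \<open>D \<union> A\<close> has its head in \<open>U\<close>, so a path can
  meet \<open>U\<close> only in its starting point. A cycle would therefore avoid \<open>U\<close>
  and lie in \<open>D\<close>.\<close>

lemma acyclic_Un_out:
  assumes "acyclic D" "\<forall>(x, y) \<in> D. x \<notin> U \<and> y \<notin> U" "\<forall>(x, y) \<in> A. x \<in> U \<and> y \<notin> U"
  shows "acyclic (D \<union> A)"
proof -
  \<comment> \<open>Invariant along a path: it ends outside \<open>U\<close>, and if it also starts
    outside \<open>U\<close>, it uses only arcs of \<open>D\<close>.\<close>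
  have "y \<notin> U \<and> (x \<notin> U \<longrightarrow> (x, y) \<in> D\<^sup>+)" if "(x, y) \<in> (D \<union> A)\<^sup>+" for x y
    using that
  proof (induction rule: trancl_induct)
    case (base y)
    then show ?case using assms by auto
  next
    case (step y z)
    then show ?case using assms by (auto intro: trancl_into_trancl)
  qed
  then show ?thesis
    using assms(1) unfolding acyclic_def by blast
qed

text \<open>Deleting \<open>U\<close> is inverse to orienting all edges at \<open>U\<close> away from \<open>U\<close>.\<close>

lemma num_acyclic_orientations_delete_independent:
  assumes E: "\<forall>e\<in>E. \<exists>x y. e = {x, y}" and U: "\<forall>e\<in>E. \<not> e \<subseteq> U"
  shows "num_acyclic_orientations (W, {e \<in> E. e \<inter> U = {}}) =
    card {D \<in> orientations (W', E). acyclic D \<and> U \<inter> Range D = {}}"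
proof -
  define A where "A = {(x, y). {x, y} \<in> E \<and> x \<in> U \<and> y \<notin> U}"
  let ?L = "{D \<in> orientations (W', E). acyclic D \<and> U \<inter> Range D = {}}"
  let ?R = "{D \<in> orientations (W, {e \<in> E. e \<inter> U = {}}). acyclic D}"
  \<comment> \<open>Testing the tail is enough: in \<open>?L\<close> no arc has its head in
    \<open>U\<close>, so \<open>r\<close> removes every arc that meets \<open>U\<close>.\<close>
  define r :: "('a \<times> 'a) set \<Rightarrow> ('a \<times> 'a) set" where "r D = {a \<in> D. fst a \<notin> U}" for D
  have "bij_betw r ?L ?R"
  proof (rule bij_betw_byWitness[where f' = "\<lambda>D. D \<union> A"])
    show "\<forall>D\<in>?L. r D \<union> A = D"
    proof
      fix D assume D: "D \<in> ?L"
      have "(x, y) \<in> D" if "(x, y) \<in> A" for x y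
      proof -
        have xy: "{x, y} \<in> E" "x \<in> U" using that by (auto simp: A_def)
        then have "\<exists>!a. a \<in> D \<and> {fst a, snd a} = {x, y}"
          using D unfolding orientations_def by simp
        then obtain a where a: "a \<in> D" "{fst a, snd a} = {x, y}" by blast
        have "snd a \<in> Range D" using a(1) by (auto intro: RangeI[of "fst a"])
        \<comment> \<open>The arc chosen for \<open>{x, y}\<close> cannot point at \<open>x\<close>,
          which has no incoming arc in \<open>D\<close>, so it is \<open>(x, y)\<close>.\<close>
        then have "snd a \<noteq> x" using D xy(2) by blast
        then show ?thesis using a by (cases a) (auto simp: doubleton_eq_iff)
      qed
      moreover have "(x, y) \<in> A" if "(x, y) \<in> D" "x \<in> U" for x y
        using that D unfolding A_def orientations_def by auto
      ultimately show "r D \<union> A = D" unfolding r_def by auto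
    qed
    show "\<forall>D\<in>?R. r (D \<union> A) = D"
      unfolding r_def A_def orientations_def by fastforce
    show "r ` ?L \<subseteq> ?R"
    proof
      fix D' assume "D' \<in> r ` ?L"
      then obtain D where D: "D \<in> ?L" "D' = r D" by blast
      have "\<exists>!a. a \<in> D' \<and> {fst a, snd a} = e" if e: "e \<in> E" "e \<inter> U = {}" for e
      proof -
        have "\<exists>!a. a \<in> D \<and> {fst a, snd a} = e"
          using D(1) e(1) unfolding orientations_def by auto
        moreover have "fst a \<notin> U" if "{fst a, snd a} = e" for a
          using that e(2) by auto
        ultimately show ?thesis unfolding D(2) r_def by auto
      qed
      moreover have "acyclic D'"
        using D acyclic_subset[of D "r D"] by (auto simp: r_def)
      ultimately show "D' \<in> ?R"
        using D unfolding orientations_def by (auto simp: r_def)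
    qed
    show "(\<lambda>D. D \<union> A) ` ?R \<subseteq> ?L"
    proof
      fix D' assume "D' \<in> (\<lambda>D. D \<union> A) ` ?R"
      then obtain D where D: "D \<in> ?R" "D' = D \<union> A" by blast
      have out: "\<forall>(x, y) \<in> D. x \<notin> U \<and> y \<notin> U" "\<forall>(x, y) \<in> A. x \<in> U \<and> y \<notin> U"
        using D(1) unfolding orientations_def A_def by auto
      have "\<exists>!a. a \<in> D' \<and> {fst a, snd a} = e" if e: "e \<in> E" for e
      proof (cases "e \<inter> U = {}")
        case True
        then have "\<exists>!a. a \<in> D \<and> {fst a, snd a} = e"
          using D(1) e unfolding orientations_def by auto
        moreover have "a \<notin> A" if "{fst a, snd a} = e" for a
          using that True out(2) by auto
        ultimately show ?thesis unfolding D(2) by blast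
      next
        case False
        then obtain x y where xy: "e = {x, y}" "x \<in> U"
          using E e by (metis disjoint_iff insertE insert_commute singletonD)
        then have y: "y \<notin> U" using U e by auto
        show ?thesis
        proof (rule ex1I[of _ "(x, y)"])
          show "(x, y) \<in> D' \<and> {fst (x, y), snd (x, y)} = e"
            using e xy y by (simp add: D(2) A_def)
          show "a = (x, y)" if "a \<in> D' \<and> {fst a, snd a} = e" for a
            using that out xy y unfolding D(2) by (cases a) (auto simp: doubleton_eq_iff)
        qed
      qed
      moreover have "acyclic D'"
        unfolding D(2) using D(1) out by (intro acyclic_Un_out[of D U A]) auto
      moreover have "\<forall>(x, y) \<in> D'. {x, y} \<in> E"
        using D(1) unfolding D(2) A_def orientations_def by auto
      ultimately show "D' \<in> ?L"
        using out unfolding orientations_def D(2) by auto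
    qed
  qed
  then show ?thesis
    unfolding num_acyclic_orientations_def by (rule bij_betw_same_card[symmetric])
qed

text \<open>A finite acyclic relation is well-founded, and a minimal element of \<open>W\<close> has
  no incoming arc.\<close>

lemma acyclic_has_source:
  assumes "finite W" "W \<noteq> {}" "D \<subseteq> W \<times> W" "acyclic D"
  shows "W - Range D \<noteq> {}"
proof -
  have "finite D" using assms finite_subset by blast
  then have "wf D" using assms(4) finite_acyclic_wf by blast
  then obtain z where "z \<in> W" "\<And>y. (y, z) \<in> D \<Longrightarrow> y \<notin> W"
    using assms(2) wfE_min by (metis equals0I)
  then show ?thesis using assms(3) by blast
qed

text \<open>The sum counts pairs of an acyclic orientation \<open>D\<close> of the whole graph and a
  set \<open>U\<close> of sources of \<open>D\<close>, with sign \<open>(- 1) ^ card U\<close>.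
  After exchanging the sums, \<open>U\<close> runs through all subsets of the nonempty set of
  sources of \<open>D\<close>, and the signs cancel.\<close>

lemma sum_independent_acyclic_orientations:
  assumes E: "\<forall>e\<in>E. \<exists>x\<in>W. \<exists>y\<in>W. e = {x, y}" and W: "finite W" "W \<noteq> {}"
  shows "(\<Sum>U | U \<subseteq> W \<and> (\<forall>e\<in>E. \<not> e \<subseteq> U).
    (- 1) ^ card U * of_nat (num_acyclic_orientations (W - U, {e \<in> E. e \<inter> U = {}}))) =
    (0 :: 'b::comm_ring_1)"
proof -
  let ?O = "{D \<in> orientations (W, E). acyclic D}"
  let ?I = "{U. U \<subseteq> W \<and> (\<forall>e\<in>E. \<not> e \<subseteq> U)}"
  have E': "\<forall>e\<in>E. \<exists>x y. e = {x, y}"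
    using E by meson
  have arcs: "D \<subseteq> W \<times> W" if "D \<in> ?O" for D
  proof
    fix a assume "a \<in> D"
    then have "{fst a, snd a} \<in> E" using that unfolding orientations_def by auto
    then show "a \<in> W \<times> W" using E by (metis insert_subset mem_Times_iff empty_subsetI)
  qed
  then have fin: "finite ?O"
    using finite_subset[of ?O "Pow (W \<times> W)"] W(1) by blast
  \<comment> \<open>A set of sources is automatically independent: the arc orienting an edge inside
    \<open>U\<close> would have its head in \<open>U\<close>.\<close>
  have indep: "D \<notin> ?O" if "e \<in> E" "e \<subseteq> U" "U \<inter> Range D = {}" for e U D
  proof
    assume "D \<in> ?O"
    then have "\<exists>!a. a \<in> D \<and> {fst a, snd a} = e"
      using that(1) unfolding orientations_def by simp
    then obtain a where "a \<in> D" "{fst a, snd a} = e" by blast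
    then have "snd a \<in> U" "snd a \<in> Range D"
      using that(2) by (auto intro: RangeI[of "fst a"])
    then show False using that(3) by blast
  qed
  have "(\<Sum>U\<in>?I. (- 1) ^ card U * of_nat (num_acyclic_orientations (W - U, {e \<in> E. e \<inter> U = {}}))) =
    (\<Sum>U\<in>?I. \<Sum>D\<in>?O. if U \<inter> Range D = {} then (- 1) ^ card U else 0 :: 'b)"
  proof (rule sum.cong[OF refl])
    fix U assume U: "U \<in> ?I"
    have "num_acyclic_orientations (W - U, {e \<in> E. e \<inter> U = {}}) =
      card {D \<in> orientations (W, E). acyclic D \<and> U \<inter> Range D = {}}"
      using U by (intro num_acyclic_orientations_delete_independent[OF E']) simp
    also have "\<dots> = card {D \<in> ?O. U \<inter> Range D = {}}"
      by (rule arg_cong[of _ _ card]) auto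
    finally show "(- 1) ^ card U * of_nat (num_acyclic_orientations (W - U, {e \<in> E. e \<inter> U = {}})) =
      (\<Sum>D\<in>?O. if U \<inter> Range D = {} then (- 1) ^ card U else 0 :: 'b)"
      using fin by (simp add: sum.If_cases Int_def mult.commute)
  qed
  also have "\<dots> = (\<Sum>D\<in>?O. \<Sum>U\<in>?I. if U \<inter> Range D = {} then (- 1) ^ card U else 0)"
    by (rule sum.swap)
  \<comment> \<open>By \<open>indep\<close>, the independent sets without incoming arcs are exactly
    the subsets of the source set \<open>W - Range D\<close>.\<close>
  also have "\<dots> = (\<Sum>D\<in>?O. \<Sum>U\<in>Pow (W - Range D). (- 1) ^ card U)"
  proof (rule sum.cong[OF refl])
    fix D assume D: "D \<in> ?O"
    have "{U \<in> ?I. U \<inter> Range D = {}} = Pow (W - Range D)"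
      using indep D by blast
    moreover have "finite ?I" using W(1) by auto
    ultimately show "(\<Sum>U\<in>?I. if U \<inter> Range D = {} then (- 1) ^ card U else 0 :: 'b) =
      (\<Sum>U\<in>Pow (W - Range D). (- 1) ^ card U)"
      by (simp add: sum.inter_filter[symmetric])
  qed
  also have "\<dots> = 0"
  proof (rule sum.neutral, rule ballI)
    fix D assume "D \<in> ?O"
    then show "(\<Sum>U\<in>Pow (W - Range D). (- 1) ^ card U) = (0 :: 'b)"
      using acyclic_has_source[OF W arcs] W(1) by (intro sum_neg_one_power_card_Pow) auto
  qed
  finally show ?thesis .
qed


section \<open>Components, flats and contractions\<close>

definition reach :: "'a set set \<Rightarrow> ('a \<times> 'a) set" where
  "reach F = {(x, y). {x, y} \<in> F}\<^sup>*"

text \<open>The vertex set enters only here: \<open>reach\<close> sees the edges alone and can thus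
  be compared between a graph and its restrictions.\<close>

definition component :: "'a set \<Rightarrow> 'a set set \<Rightarrow> 'a \<Rightarrow> 'a set" where
  "component V F u = {v \<in> V. (u, v) \<in> reach F}"

lemma reach_refl [simp]: "(u, u) \<in> reach F"
  by (simp add: reach_def)

lemma reach_edge: "{u, v} \<in> F \<Longrightarrow> (u, v) \<in> reach F"
  by (auto simp: reach_def)

lemma reach_sym: "(u, v) \<in> reach F \<Longrightarrow> (v, u) \<in> reach F"
proof -
  have "sym {(x, y). {x, y} \<in> F}"
    by (auto simp: sym_def insert_commute)
  then show "(u, v) \<in> reach F \<Longrightarrow> (v, u) \<in> reach F"
    unfolding reach_def by (metis sym_rtrancl symD)
qed

lemma reach_trans: "(u, v) \<in> reach F \<Longrightarrow> (v, w) \<in> reach F \<Longrightarrow> (u, w) \<in> reach F"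
  by (simp add: reach_def)

text \<open>Replaces the quotient by an image, so that a component can be named by any of its
  vertices.\<close>

lemma connected_components_eq: "connected_components (V, F) = component V F ` V"
proof -
  have "{(u, v) \<in> V \<times> V. (u, v) \<in> reach F} `` {u} = component V F u" if "u \<in> V" for u
    using that by (auto simp: component_def)
  then show ?thesis
    unfolding connected_components_def quotient_def reach_def by auto
qed

lemma component_self: "u \<in> V \<Longrightarrow> u \<in> component V F u"
  by (simp add: component_def)

lemma component_subset: "component V F u \<subseteq> V"
  by (auto simp: component_def)

lemma component_eqI:
  assumes "(u, v) \<in> reach F"
  shows "component V F u = component V F v"
  unfolding component_def using assms by (meson reach_sym reach_trans Collect_cong)

lemma component_of_mem:
  assumes "C \<in> component V F ` V" "v \<in> C"
  shows "C = component V F v"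
proof -
  obtain u where "C = component V F u" using assms(1) by blast
  then show ?thesis using assms(2) component_eqI[of u v F V] by (simp add: component_def)
qed

text \<open>The ends of an edge lie in one component of \<open>(V, F)\<close> exactly when
  \<open>F\<close> joins them, so induced components mean that \<open>F\<close> is closed: these are
  the flats of the graphic matroid. In this form only paths have to be followed.\<close>

lemma flats_iff:
  assumes E: "\<forall>e\<in>E. \<exists>x\<in>V. \<exists>y\<in>V. e = {x, y}"
  shows "F \<in> flats (V, E) \<longleftrightarrow>
    F \<subseteq> E \<and> (\<forall>u v. {u, v} \<in> E \<longrightarrow> (u, v) \<in> reach F \<longrightarrow> {u, v} \<in> F)"
proof -
  have "(\<forall>C \<in> component V F ` V. {e \<in> F. e \<subseteq> C} = {e \<in> E. e \<subseteq> C}) \<longleftrightarrow>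
      (\<forall>u v. {u, v} \<in> E \<longrightarrow> (u, v) \<in> reach F \<longrightarrow> {u, v} \<in> F)"
    if F: "F \<subseteq> E"
  proof safe
    fix u v
    assume *: "\<forall>C \<in> component V F ` V. {e \<in> F. e \<subseteq> C} = {e \<in> E. e \<subseteq> C}"
      and uv: "{u, v} \<in> E" "(u, v) \<in> reach F"
    have "u \<in> V" "v \<in> V"
      using E uv(1) by (auto simp: doubleton_eq_iff dest!: bspec)
    then have "{u, v} \<subseteq> component V F u" "component V F u \<in> component V F ` V"
      using uv(2) by (auto simp: component_def)
    then show "{u, v} \<in> F" using * uv(1) by blast
  next
    fix w e
    assume *: "\<forall>u v. {u, v} \<in> E \<longrightarrow> (u, v) \<in> reach F \<longrightarrow> {u, v} \<in> F"
      and e: "e \<in> E" "e \<subseteq> component V F w"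
    obtain x y where xy: "e = {x, y}" using E e(1) by meson
    then have "(x, y) \<in> reach F"
      using e(2) by (auto simp: component_def intro: reach_trans reach_sym)
    then show "e \<in> F" using * e(1) xy by blast
  qed (use F in blast)
  then show ?thesis
    unfolding flats_def induced_subgraph_def connected_components_eq by (simp cong: conj_cong)
qed

text \<open>The saturated sets are the unions of components of \<open>(V, F)\<close>.\<close>

definition saturated :: "'a set set \<Rightarrow> 'a set \<Rightarrow> bool" where
  "saturated F T \<longleftrightarrow> (\<forall>e\<in>F. e \<subseteq> T \<or> e \<inter> T = {})"

text \<open>No edge of \<open>F\<close> crosses the boundary of \<open>T\<close>, so a path that
  starts in \<open>T\<close> never leaves it and uses only edges inside \<open>T\<close>.\<close>

lemma reach_saturated:
  assumes "saturated F T" "u \<in> T" "(u, v) \<in> reach F"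
  shows "v \<in> T \<and> (u, v) \<in> reach {e \<in> F. e \<subseteq> T}"
  using assms(3) unfolding reach_def
proof (induction rule: rtrancl_induct)
  case (step y z)
  then have "{y, z} \<subseteq> T" using assms(1) by (auto simp: saturated_def)
  then show ?case using step by (auto intro: rtrancl_into_rtrancl)
qed (use assms(2) in simp)

lemma reach_mono: "F \<subseteq> F' \<Longrightarrow> (u, v) \<in> reach F \<Longrightarrow> (u, v) \<in> reach F'"
  unfolding reach_def by (erule rev_subsetD, rule rtrancl_mono) auto

lemma component_saturated:
  assumes "saturated F T" "T \<subseteq> V" "u \<in> T"
  shows "component T {e \<in> F. e \<subseteq> T} u = component V F u"
proof -
  have "(u, v) \<in> reach F \<longleftrightarrow> v \<in> T \<and> (u, v) \<in> reach {e \<in> F. e \<subseteq> T}"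
    if "(u, v) \<in> reach F \<or> v \<in> T" for v
    using that reach_saturated[OF assms(1,3), of v] reach_mono[of "{e \<in> F. e \<subseteq> T}" F u v] by blast
  then show ?thesis
    using assms(2) unfolding component_def by blast
qed

text \<open>Components are nonempty, and by saturation none of them has vertices on both sides of
  \<open>T\<close>.\<close>

lemma component_saturated_dichotomy:
  assumes "saturated F T" "T \<subseteq> V" "C \<in> component V F ` V"
  shows "C \<subseteq> T \<longleftrightarrow> C \<inter> T \<noteq> {}"
proof
  show "C \<inter> T \<noteq> {}" if "C \<subseteq> T"
    using assms(3) that component_self[of _ V F] by blast
  show "C \<subseteq> T" if ne: "C \<inter> T \<noteq> {}"
  proof -
    obtain v where v: "v \<in> C" "v \<in> T" using ne by blast
    then have "C = component V F v" using component_of_mem[OF assms(3)] by blast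
    also have "\<dots> = component T {e \<in> F. e \<subseteq> T} v"
      using component_saturated[OF assms(1,2) v(2)] by simp
    finally show ?thesis by (simp add: component_subset)
  qed
qed

lemma components_restrict:
  assumes "saturated F T" "T \<subseteq> V"
  shows "connected_components (T, {e \<in> F. e \<subseteq> T}) = {C \<in> connected_components (V, F). C \<subseteq> T}"
proof -
  have "component V F u \<subseteq> T" if "u \<in> T" for u
    using component_saturated[OF assms that] component_subset[of T "{e \<in> F. e \<subseteq> T}" u] by simp
  moreover have "u \<in> T" if "u \<in> V" "component V F u \<subseteq> T" for u
    using that(2) component_self[OF that(1)] by (rule subsetD)
  ultimately have "{C \<in> component V F ` V. C \<subseteq> T} = component V F ` T"
    using assms(2) by blast
  also have "\<dots> = component T {e \<in> F. e \<subseteq> T} ` T"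
    using component_saturated[OF assms] by simp
  finally show ?thesis
    unfolding connected_components_eq by simp
qed

lemma edges_within:
  assumes "\<forall>e\<in>E. \<exists>x\<in>V. \<exists>y\<in>V. e = {x, y}"
  shows "\<forall>e\<in>{e \<in> E. e \<subseteq> T}. \<exists>x\<in>T. \<exists>y\<in>T. e = {x, y}"
proof
  fix e assume e: "e \<in> {e \<in> E. e \<subseteq> T}"
  then obtain x y where xy: "e = {x, y}" using assms by (elim CollectE conjE) (drule (1) bspec, elim bexE)
  then have "x \<in> T" "y \<in> T" using e by auto
  then show "\<exists>x\<in>T. \<exists>y\<in>T. e = {x, y}" using xy by (intro bexI)
qed

text \<open>A path in the restricted edge set is also a path in \<open>F\<close>, so closedness is
  inherited.\<close>

lemma flats_restrict:
  assumes E: "\<forall>e\<in>E. \<exists>x\<in>V. \<exists>y\<in>V. e = {x, y}" and F: "F \<in> flats (V, E)"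
    and T: "saturated F T"
  shows "{e \<in> F. e \<subseteq> T} \<in> flats (T, {e \<in> E. e \<subseteq> T})"
  unfolding flats_iff[OF edges_within[OF E]]
proof -
  show "{e \<in> F. e \<subseteq> T} \<subseteq> {e \<in> E. e \<subseteq> T} \<and>
    (\<forall>u v. {u, v} \<in> {e \<in> E. e \<subseteq> T} \<longrightarrow> (u, v) \<in> reach {e \<in> F. e \<subseteq> T} \<longrightarrow> {u, v} \<in> {e \<in> F. e \<subseteq> T})"
    using F reach_mono[of "{e \<in> F. e \<subseteq> T}" F] unfolding flats_iff[OF E] by auto
qed

text \<open>A path in \<open>F'\<close> stays on one side of \<open>T\<close>. Inside
  \<open>T\<close> the flat \<open>F\<close> is closed, and outside \<open>T\<close> all edges
  belong to \<open>F'\<close>. Restriction to \<open>T\<close> recovers \<open>F\<close>, which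
  makes this the inverse of \<open>flats_restrict\<close> in the later reindexing.\<close>

lemma flats_extend:
  assumes E: "\<forall>e\<in>E. \<exists>x\<in>V. \<exists>y\<in>V. e = {x, y}" and T: "T \<subseteq> V"
    and F: "F \<in> flats (T, {e \<in> E. e \<subseteq> T})"
  defines "F' \<equiv> F \<union> {e \<in> E. e \<inter> T = {}}"
  shows "F' \<in> flats (V, E)" "saturated F' T" "{e \<in> F'. e \<subseteq> T} = F"
proof -
  note ET = edges_within[OF E, of T]
  have F1: "F \<subseteq> E" "\<forall>e\<in>F. e \<subseteq> T"
    and F2: "\<And>u v. {u, v} \<in> E \<Longrightarrow> {u, v} \<subseteq> T \<Longrightarrow> (u, v) \<in> reach F \<Longrightarrow> {u, v} \<in> F"
    using F unfolding flats_iff[OF ET] by auto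
  \<comment> \<open>An empty edge would be both inside \<open>T\<close> and disjoint from it, and
    would spoil the recovery of \<open>F\<close> from \<open>F'\<close>.\<close>
  have ne: "e \<noteq> {}" if "e \<in> E" for e
    using E that by (metis insert_not_empty)
  show sat: "saturated F' T"
    using F1 by (auto simp: saturated_def F'_def)
  show restr: "{e \<in> F'. e \<subseteq> T} = F"
    using F1 ne unfolding F'_def by blast
  have "{u, v} \<in> F'" if uv: "{u, v} \<in> E" "(u, v) \<in> reach F'" for u v
  proof (cases "u \<in> T")
    case True
    then have "v \<in> T" "(u, v) \<in> reach F"
      using reach_saturated[OF sat True uv(2)] restr by auto
    then show ?thesis using F2 uv(1) True by (simp add: F'_def)
  next
    case False
    then have "v \<notin> T"
      using reach_saturated[OF sat _ reach_sym[OF uv(2)]] by blast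
    then show ?thesis using uv(1) False by (simp add: F'_def)
  qed
  then show "F' \<in> flats (V, E)"
    using F1(1) unfolding flats_iff[OF E] by (auto simp: F'_def)
qed

section \<open>Contractions and unions of components\<close>

lemma contract_eq:
  "contract (V, E) F =
    (component V F ` V, (\<lambda>e. {C \<in> component V F ` V. C \<inter> e \<noteq> {}}) ` (E - F))"
  by (simp add: contract_def connected_components_eq Setcompr_eq_image del: Diff_iff)

lemma components_meeting_edge:
  assumes "x \<in> V" "y \<in> V"
  shows "{C \<in> component V F ` V. C \<inter> {x, y} \<noteq> {}} = {component V F x, component V F y}"
proof
  show "{C \<in> component V F ` V. C \<inter> {x, y} \<noteq> {}} \<subseteq> {component V F x, component V F y}"
    using component_of_mem[of _ V F] by blast
  show "{component V F x, component V F y} \<subseteq> {C \<in> component V F ` V. C \<inter> {x, y} \<noteq> {}}"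
    using assms component_self[of _ V F] by blast
qed

text \<open>Each component lies in \<open>T\<close> or avoids it. Hence the image of an edge
  \<open>e\<close> in \<open>G/F\<close> avoids \<open>U\<close> iff \<open>e\<close> lies in
  \<open>T\<close>, and lies within \<open>U\<close> iff \<open>e\<close> avoids \<open>T\<close>.
  So contracting the graph induced on \<open>T\<close> amounts to deleting \<open>U\<close> from
  \<open>G/F\<close>, and independence of \<open>U\<close> is a condition on the edges that avoid
  \<open>T\<close>.\<close>

lemma contract_restrict:
  assumes E: "\<forall>e\<in>E. \<exists>x\<in>V. \<exists>y\<in>V. e = {x, y}" and T: "T \<subseteq> V" "saturated F T"
  defines "U \<equiv> {C \<in> component V F ` V. C \<inter> T = {}}"
  shows "contract (T, {e \<in> E. e \<subseteq> T}) {e \<in> F. e \<subseteq> T} =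
    (component V F ` V - U, {h \<in> snd (contract (V, E) F). h \<inter> U = {}})"
    and "(\<forall>h\<in>snd (contract (V, E) F). \<not> h \<subseteq> U) \<longleftrightarrow> (\<forall>e\<in>E. e \<inter> T = {} \<longrightarrow> e \<in> F)"
proof -
  let ?K = "component V F ` V"
  let ?h = "\<lambda>e. {C \<in> ?K. C \<inter> e \<noteq> {}}"
  have K: "component T {e \<in> F. e \<subseteq> T} ` T = {C \<in> ?K. C \<subseteq> T}"
    using components_restrict[OF T(2,1)] unfolding connected_components_eq .
  have sub: "C \<subseteq> T \<longleftrightarrow> C \<inter> T \<noteq> {}" if "C \<in> ?K" for C
    using component_saturated_dichotomy[OF T(2,1) that] .
  have in_U: "component V F x \<in> U \<longleftrightarrow> x \<notin> T" if "x \<in> V" for x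
    using sub[of "component V F x"] that component_self[OF that] unfolding U_def by blast
  have h1: "?h e \<inter> U = {} \<longleftrightarrow> e \<subseteq> T" and h2: "?h e \<subseteq> U \<longleftrightarrow> e \<inter> T = {}" if "e \<in> E" for e
  proof -
    obtain x y where xy: "x \<in> V" "y \<in> V" "e = {x, y}" using E \<open>e \<in> E\<close> by meson
    show "?h e \<inter> U = {} \<longleftrightarrow> e \<subseteq> T" "?h e \<subseteq> U \<longleftrightarrow> e \<inter> T = {}"
      unfolding xy(3) components_meeting_edge[OF xy(1,2)] using in_U xy by auto
  qed
  have "{C \<in> ?K. C \<subseteq> T} = ?K - U"
    using sub unfolding U_def by blast
  moreover have "(\<lambda>e. {C \<in> {C \<in> ?K. C \<subseteq> T}. C \<inter> e \<noteq> {}}) ` ({e \<in> E. e \<subseteq> T} - {e \<in> F. e \<subseteq> T}) =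
    {h \<in> ?h ` (E - F). h \<inter> U = {}}" (is "?f ` ?A = ?B")
  proof -
    have "?f ` ?A = ?h ` ?A"
    proof (rule image_cong[OF refl])
      fix e assume "e \<in> ?A"
      then have "e \<subseteq> T" by blast
      then show "?f e = ?h e" using sub by blast
    qed
    moreover have "?A = {e \<in> E - F. ?h e \<inter> U = {}}"
    proof -
      have "?A = {e \<in> E - F. e \<subseteq> T}" by blast
      also have "\<dots> = {e \<in> E - F. ?h e \<inter> U = {}}"
        by (intro Collect_cong conj_cong refl h1[symmetric]) simp
      finally show ?thesis .
    qed
    moreover have "?h ` {e \<in> E - F. ?h e \<inter> U = {}} = ?B" by blast
    ultimately show ?thesis by (simp only:)
  qed
  ultimately show "contract (T, {e \<in> E. e \<subseteq> T}) {e \<in> F. e \<subseteq> T} =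
    (?K - U, {h \<in> snd (contract (V, E) F). h \<inter> U = {}})"
    unfolding contract_eq K snd_conv by simp
  show "(\<forall>h\<in>snd (contract (V, E) F). \<not> h \<subseteq> U) \<longleftrightarrow> (\<forall>e\<in>E. e \<inter> T = {} \<longrightarrow> e \<in> F)"
    unfolding contract_eq snd_conv by (auto simp add: h2)
qed

text \<open>A saturated set is determined by the components it misses, and these may be any set of
  components. The missed components are used because they form the set \<open>U\<close> that is
  deleted from \<open>G/F\<close>.\<close>

lemma bij_betw_saturated:
  assumes F: "\<forall>e\<in>F. \<exists>x\<in>V. \<exists>y\<in>V. e = {x, y}"
  shows "bij_betw (\<lambda>T. {C \<in> component V F ` V. C \<inter> T = {}})
    {T. T \<subseteq> V \<and> saturated F T} (Pow (component V F ` V))"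
proof (rule bij_betw_byWitness[where f' = "\<lambda>U. V - \<Union>U"])
  let ?K = "component V F ` V"
  show "\<forall>T\<in>{T. T \<subseteq> V \<and> saturated F T}. V - \<Union>{C \<in> ?K. C \<inter> T = {}} = T"
  proof
    fix T assume T: "T \<in> {T. T \<subseteq> V \<and> saturated F T}"
    have "v \<in> \<Union>{C \<in> ?K. C \<inter> T = {}}" if "v \<in> V" "v \<notin> T" for v
      using component_saturated_dichotomy[of F T V "component V F v"] T that
        component_self[OF that(1)] by blast
    then show "V - \<Union>{C \<in> ?K. C \<inter> T = {}} = T" using T by blast
  qed
  show "\<forall>U\<in>Pow ?K. {C \<in> ?K. C \<inter> (V - \<Union>U) = {}} = U"
  proof
    fix U assume U: "U \<in> Pow ?K"
    have "C \<in> U" if C: "C \<in> ?K" "C \<inter> (V - \<Union>U) = {}" for C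
    proof -
      obtain v where v: "v \<in> C" "v \<in> V" using C(1) component_self by fast
      then obtain D where D: "D \<in> U" "v \<in> D" using C(2) by blast
      then have "D = component V F v" "C = component V F v"
        using U C(1) v(1) component_of_mem[of D V F v] component_of_mem[of C V F v] by blast+
      then show ?thesis using D(1) by simp
    qed
    moreover have "C \<inter> (V - \<Union>U) = {}" if "C \<in> U" for C
      using that by blast
    ultimately show "{C \<in> ?K. C \<inter> (V - \<Union>U) = {}} = U" using U by blast
  qed
  show "(\<lambda>U. V - \<Union>U) ` Pow ?K \<subseteq> {T. T \<subseteq> V \<and> saturated F T}"
  proof -
    have "e \<inter> (V - \<Union>U) = {}" if U: "U \<subseteq> ?K" and e: "e \<in> F" "\<not> e \<subseteq> V - \<Union>U" for U e
    proof -
      obtain x y where xy: "x \<in> V" "y \<in> V" "e = {x, y}" using F e(1) by meson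
      \<comment> \<open>Both ends of an edge of \<open>F\<close> share a component, so an edge that
        touches \<open>\<Union>U\<close> lies wholly in it.\<close>
      have eq: "component V F x = component V F y"
        using xy e(1) by (intro component_eqI reach_edge) simp
      obtain z C where z: "z \<in> e" "C \<in> U" "z \<in> C" using e(2) xy by blast
      then have "C = component V F z" using U component_of_mem[of C V F z] by blast
      then have "C = component V F x" using z(1) xy eq by auto
      then have "{x, y} \<subseteq> C"
        using eq component_self[OF xy(1), of F] component_self[OF xy(2), of F] by simp
      then show ?thesis using xy z by blast
    qed
    then have "saturated F (V - \<Union>U)" if "U \<subseteq> ?K" for U
      using that unfolding saturated_def by blast
    then show ?thesis by blast
  qed
  show "(\<lambda>T. {C \<in> ?K. C \<inter> T = {}}) ` {T. T \<subseteq> V \<and> saturated F T} \<subseteq> Pow ?K"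
    by (rule image_subsetI) simp
qed

text \<open>The coefficient of the flat \<open>F\<close> in \<open>\<Sum>T. S(\<Gamma>\<^sub>T) \<cdot> \<Gamma>\<^bsub>V - T\<^esub>\<close>.\<close>

lemma flat_coefficient_zero:
  assumes E: "\<forall>e\<in>E. \<exists>x\<in>V. \<exists>y\<in>V. e = {x, y}" and V: "finite V" "V \<noteq> {}" and F: "F \<subseteq> E"
  shows "(\<Sum>T | T \<subseteq> V \<and> saturated F T \<and> (\<forall>e\<in>E. e \<inter> T = {} \<longrightarrow> e \<in> F).
    (- 1) ^ card (connected_components (T, {e \<in> F. e \<subseteq> T})) *
    of_nat (num_acyclic_orientations (contract (T, {e \<in> E. e \<subseteq> T}) {e \<in> F. e \<subseteq> T}))) =
    (0 :: 'b::comm_ring_1)"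
proof -
  let ?K = "component V F ` V"
  let ?H = "snd (contract (V, E) F)"
  let ?u = "\<lambda>T. {C \<in> ?K. C \<inter> T = {}}"
  let ?S = "{T. T \<subseteq> V \<and> saturated F T \<and> (\<forall>e\<in>E. e \<inter> T = {} \<longrightarrow> e \<in> F)}"
  let ?I = "{U. U \<subseteq> ?K \<and> (\<forall>h\<in>?H. \<not> h \<subseteq> U)}"
  let ?g = "\<lambda>U. (- 1) ^ card U * of_nat (num_acyclic_orientations (?K - U, {h \<in> ?H. h \<inter> U = {}})) :: 'b"
  have FV: "\<forall>e\<in>F. \<exists>x\<in>V. \<exists>y\<in>V. e = {x, y}" using E F by blast
  have bij: "bij_betw ?u {T. T \<subseteq> V \<and> saturated F T} (Pow ?K)"
    by (rule bij_betw_saturated[OF FV])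
  have "(\<forall>h\<in>?H. \<not> h \<subseteq> ?u T) \<longleftrightarrow> (\<forall>e\<in>E. e \<inter> T = {} \<longrightarrow> e \<in> F)"
    if "T \<in> {T. T \<subseteq> V \<and> saturated F T}" for T
    using contract_restrict(2)[OF E, of T F] that by simp
  \<comment> \<open>The bijection with all sets of components restricts to one with the independent
    sets of \<open>G/F\<close>.\<close>
  from bij_betw_Collect[where Q = "\<lambda>U. \<forall>h\<in>?H. \<not> h \<subseteq> U", OF bij this] have bij': "bij_betw ?u ?S ?I"
    by (simp add: conj_assoc Pow_def)
  have "(\<Sum>T\<in>?S. (- 1) ^ card (connected_components (T, {e \<in> F. e \<subseteq> T})) *
      of_nat (num_acyclic_orientations (contract (T, {e \<in> E. e \<subseteq> T}) {e \<in> F. e \<subseteq> T}))) =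
    (\<Sum>T\<in>?S. (- 1) ^ card ?K * ?g (?u T))"
  proof (rule sum.cong[OF refl])
    fix T assume T: "T \<in> ?S"
    have "connected_components (T, {e \<in> F. e \<subseteq> T}) = {C \<in> ?K. C \<subseteq> T}"
      using T components_restrict[of F T V] by (simp only: connected_components_eq mem_Collect_eq)
    also have "\<dots> = {C \<in> ?K. C \<inter> T \<noteq> {}}"
      by (intro Collect_cong conj_cong refl component_saturated_dichotomy) (use T in simp_all)
    also have "\<dots> = ?K - ?u T" by blast
    finally have "connected_components (T, {e \<in> F. e \<subseteq> T}) = ?K - ?u T" .
    \<comment> \<open>The sign of \<open>T\<close> thus differs from
      \<open>(- 1) ^ card (?u T)\<close> by \<open>(- 1) ^ card ?K\<close>, a factor that is the
      same for all \<open>T\<close> and can be pulled out.\<close>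
    then have "card (connected_components (T, {e \<in> F. e \<subseteq> T})) + card (?u T) = card ?K"
      using V(1) by (simp add: card_Diff_subset card_mono)
    then have "(- 1) ^ card ?K * (- 1) ^ card (?u T) =
      ((- 1) ^ card (connected_components (T, {e \<in> F. e \<subseteq> T})) :: 'b)"
      by (simp add: power_add mult.assoc flip: \<open>_ + _ = card ?K\<close>)
    then show "(- 1) ^ card (connected_components (T, {e \<in> F. e \<subseteq> T})) *
      of_nat (num_acyclic_orientations (contract (T, {e \<in> E. e \<subseteq> T}) {e \<in> F. e \<subseteq> T})) =
      (- 1) ^ card ?K * ?g (?u T)"
      using T by (simp add: contract_restrict(1)[OF E] mult.assoc[symmetric])
  qed
  also have "\<dots> = (- 1) ^ card ?K * (\<Sum>U\<in>?I. ?g U)"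
    using sum.reindex_bij_betw[OF bij', of ?g] by (simp add: sum_distrib_left[symmetric])
  also have "(\<Sum>U\<in>?I. ?g U) = 0"
  proof (rule sum_independent_acyclic_orientations)
    show "\<forall>h\<in>?H. \<exists>C\<in>?K. \<exists>D\<in>?K. h = {C, D}"
    proof
      fix h assume "h \<in> ?H"
      then obtain e where e: "e \<in> E" "h = {C \<in> ?K. C \<inter> e \<noteq> {}}"
        unfolding contract_eq by auto
      obtain x y where xy: "x \<in> V" "y \<in> V" "e = {x, y}" using E e(1) by meson
      show "\<exists>C\<in>?K. \<exists>D\<in>?K. h = {C, D}"
        unfolding e(2) xy(3) components_meeting_edge[OF xy(1,2)] using xy by blast
    qed
  qed (use V in auto)
  finally show ?thesis by simp
qed


section \<open>The antipode\<close>

lemma scale_mult_left: "scale a p * q = scale a (p * q)" for p q :: "'k::field complex_algebra"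
  by (simp add: scale_def mult_map_scale_conv_mult mult.assoc)

lemma one_skeleton_graph_eq:
  "one_skeleton_graph \<Gamma> = (vertices \<Gamma>, {e \<in> \<Gamma>. card e = 2})"
  unfolding one_skeleton_graph_def skeleton_def face_dim_def by auto

lemma one_skeleton_edge:
  assumes "simplicial_complex \<Gamma>" "e \<in> {e \<in> \<Gamma>. card e = 2}"
  shows "\<exists>x\<in>vertices \<Gamma>. \<exists>y\<in>vertices \<Gamma>. e = {x, y}"
  using assms face_subset_vertices[OF assms(1), of e] by (auto simp: card_2_iff)

text \<open>Faces are closed under subsets, so the traces on \<open>T\<close> are themselves the
  faces inside \<open>T\<close>.\<close>

lemma induced_complex_eq:
  assumes "simplicial_complex \<Gamma>"
  shows "induced_complex \<Gamma> T = {X \<in> \<Gamma>. X \<subseteq> T}"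
  using assms unfolding induced_complex_def simplicial_complex_def by (auto simp: Int_absorb2)

lemma one_skeleton_graph_induced:
  assumes "simplicial_complex \<Gamma>" "T \<subseteq> vertices \<Gamma>"
  shows "one_skeleton_graph (induced_complex \<Gamma> T) =
    (T, {e \<in> snd (one_skeleton_graph \<Gamma>). e \<subseteq> T})"
proof -
  have "vertices (induced_complex \<Gamma> T) = T"
    using assms by (simp add: vertices_induced Int_absorb1)
  then show ?thesis
    unfolding one_skeleton_graph_eq snd_conv by (auto simp: induced_complex_eq[OF assms(1)])
qed

lemma simplicial_complex_flat_subcomplex:
  assumes "simplicial_complex \<Gamma>"
  shows "simplicial_complex (flat_subcomplex \<Gamma> F)"
proof -
  have "\<Union>(flat_subcomplex \<Gamma> F) \<subseteq> \<Union>\<Gamma>"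
    by (auto simp: flat_subcomplex_def)
  then have "finite (\<Union>(flat_subcomplex \<Gamma> F))"
    using assms finite_subset unfolding simplicial_complex_def by blast
  moreover have "{} \<in> flat_subcomplex \<Gamma> F"
    using assms by (auto simp: flat_subcomplex_def simplicial_complex_def)
  moreover have "Y \<in> flat_subcomplex \<Gamma> F" if "X \<in> flat_subcomplex \<Gamma> F" "Y \<subseteq> X" for X Y
    using that assms unfolding flat_subcomplex_def simplicial_complex_def by blast
  ultimately show ?thesis
    unfolding simplicial_complex_def by blast
qed

text \<open>On disjoint vertex sets, forgetting the tags \<open>Inl\<close> and \<open>Inr\<close>
  is injective, so the tagged union is isomorphic to the plain one.\<close>

lemma mult_basis_element_disjoint:
  assumes "simplicial_complex \<Gamma>" "simplicial_complex \<Theta>" "vertices \<Gamma> \<inter> vertices \<Theta> = {}"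
  shows "basis_element \<Gamma> * basis_element \<Theta> = basis_element (\<Gamma> \<union> \<Theta>)"
proof -
  let ?f = "case_sum id id"
  have s: "simplicial_complex (disjoint_union \<Gamma> \<Theta>)"
    using assms by (simp add: simplicial_complex_disjoint_union)
  have "inj_on ?f (vertices (disjoint_union \<Gamma> \<Theta>))"
    using assms by (auto simp: vertices_disjoint_union inj_on_def)
  moreover have eq: "(image ?f) ` disjoint_union \<Gamma> \<Theta> = \<Gamma> \<union> \<Theta>"
    unfolding disjoint_union_def by (simp add: image_Un image_image)
  ultimately have "isomorphic (disjoint_union \<Gamma> \<Theta>) (\<Gamma> \<union> \<Theta>)"
    using isomorphic_imageI[OF s, of ?f] by simp
  moreover have "simplicial_complex (\<Gamma> \<union> \<Theta>)"
    using simplicial_complex_image[OF s, of ?f] unfolding eq .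
  ultimately have "iso_class (disjoint_union \<Gamma> \<Theta>) = iso_class (\<Gamma> \<union> \<Theta>)"
    using s by (simp add: iso_class_eq_iff)
  then show ?thesis
    unfolding mult_basis_element[OF assms(1,2)] by (simp add: basis_element_def)
qed

text \<open>A face with vertices on both sides of \<open>T\<close> would contain a crossing pair,
  and no such pair is in \<open>F\<close>. Conversely, a face that avoids \<open>T\<close> has all
  its pairs in \<open>F\<close> by the last hypothesis.\<close>

lemma flat_subcomplex_split:
  assumes \<Gamma>: "simplicial_complex \<Gamma>" and T: "saturated F T"
    and F: "\<forall>e\<in>\<Gamma>. card e = 2 \<longrightarrow> e \<inter> T = {} \<longrightarrow> e \<in> F"
  shows "flat_subcomplex \<Gamma> F = flat_subcomplex (induced_complex \<Gamma> T) {e \<in> F. e \<subseteq> T} \<union>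
    induced_complex \<Gamma> (vertices \<Gamma> - T)"
proof -
  have dich: "X \<subseteq> T \<or> X \<inter> T = {}" if "X \<in> flat_subcomplex \<Gamma> F" for X
  proof (rule ccontr)
    assume "\<not> (X \<subseteq> T \<or> X \<inter> T = {})"
    then obtain x y where xy: "x \<in> X" "x \<notin> T" "y \<in> X" "y \<in> T" by blast
    then have "{x, y} \<subseteq> X" "card {x, y} = 2" by (auto simp: card_2_iff)
    then have "{x, y} \<in> F" using that unfolding flat_subcomplex_def by blast
    then have "{x, y} \<subseteq> T \<or> {x, y} \<inter> T = {}" using T by (simp only: saturated_def)
    then show False using xy by simp
  qed
  have missing: "X \<in> flat_subcomplex \<Gamma> F" if "X \<in> \<Gamma>" "X \<inter> T = {}" for X
  proof -
    have "e \<in> F" if "e \<subseteq> X" "card e = 2" for e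
    proof -
      have "e \<in> \<Gamma>" using \<Gamma> \<open>X \<in> \<Gamma>\<close> that(1) by (simp add: simplicial_complex_def)
      moreover have "e \<inter> T = {}" using \<open>X \<inter> T = {}\<close> that(1) by blast
      ultimately show ?thesis using F that(2) by simp
    qed
    then show ?thesis using \<open>X \<in> \<Gamma>\<close> by (simp add: flat_subcomplex_def)
  qed
  have within: "X \<in> flat_subcomplex (induced_complex \<Gamma> T) {e \<in> F. e \<subseteq> T} \<longleftrightarrow>
    X \<in> flat_subcomplex \<Gamma> F \<and> X \<subseteq> T" for X
    unfolding induced_complex_eq[OF \<Gamma>] flat_subcomplex_def by auto
  have outside: "X \<in> induced_complex \<Gamma> (vertices \<Gamma> - T) \<longleftrightarrow> X \<in> \<Gamma> \<and> X \<inter> T = {}" for X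
    unfolding induced_complex_eq[OF \<Gamma>] using face_subset_vertices[OF \<Gamma>, of X] by auto
  show ?thesis
  proof (rule set_eqI)
    fix X
    have "X \<in> flat_subcomplex \<Gamma> F \<Longrightarrow> X \<in> \<Gamma>"
      by (simp add: flat_subcomplex_def)
    then show "X \<in> flat_subcomplex \<Gamma> F \<longleftrightarrow>
      X \<in> flat_subcomplex (induced_complex \<Gamma> T) {e \<in> F. e \<subseteq> T} \<union> induced_complex \<Gamma> (vertices \<Gamma> - T)"
      unfolding Un_iff within outside using dich[of X] missing[of X] by blast
  qed
qed

text \<open>The product does not depend on \<open>T\<close>; this is what allows the terms to be
  collected by \<open>F\<close>.\<close>

lemma mult_flat_subcomplex:
  assumes \<Gamma>: "simplicial_complex \<Gamma>" and T: "saturated F T"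
    and F: "\<forall>e\<in>\<Gamma>. card e = 2 \<longrightarrow> e \<inter> T = {} \<longrightarrow> e \<in> F"
  shows "basis_element (flat_subcomplex (induced_complex \<Gamma> T) {e \<in> F. e \<subseteq> T}) *
    basis_element (induced_complex \<Gamma> (vertices \<Gamma> - T)) = basis_element (flat_subcomplex \<Gamma> F)"
  unfolding flat_subcomplex_split[OF assms]
proof (rule mult_basis_element_disjoint)
  show "vertices (flat_subcomplex (induced_complex \<Gamma> T) {e \<in> F. e \<subseteq> T}) \<inter>
    vertices (induced_complex \<Gamma> (vertices \<Gamma> - T)) = {}"
    by (auto simp: vertices_def flat_subcomplex_def induced_complex_eq[OF \<Gamma>])
qed (simp_all add: \<Gamma> simplicial_complex_induced simplicial_complex_flat_subcomplex)

section \<open>The expansion over flats and the antipode recursion\<close>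

definition flat_coefficient :: "'a set set \<Rightarrow> 'a set set \<Rightarrow> 'k::field" where
  "flat_coefficient \<Gamma> F = (- 1) ^ card (connected_components (vertices \<Gamma>, F)) *
    of_nat (num_acyclic_orientations (contract (one_skeleton_graph \<Gamma>) F))"

definition flat_expansion :: "'a set set \<Rightarrow> 'k::field complex_algebra" where
  "flat_expansion \<Gamma> = (\<Sum>F \<in> flats (one_skeleton_graph \<Gamma>).
    scale (flat_coefficient \<Gamma> F) (basis_element (flat_subcomplex \<Gamma> F)))"

lemma sum_flat_expansion_mult:
  assumes \<Gamma>: "simplicial_complex \<Gamma>" and ne: "vertices \<Gamma> \<noteq> {}"
  shows "(\<Sum>T\<in>Pow (vertices \<Gamma>). flat_expansion (induced_complex \<Gamma> T) *
    basis_element (induced_complex \<Gamma> (vertices \<Gamma> - T))) = (0 :: 'k::field complex_algebra)"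
proof -
  define V where "V = vertices \<Gamma>"
  define E where "E = {e \<in> \<Gamma>. card e = 2}"
  let ?r = "\<lambda>T F. {e \<in> F. e \<subseteq> T}"
  let ?S = "\<lambda>F. {T. T \<subseteq> V \<and> saturated F T \<and> (\<forall>e\<in>E. e \<inter> T = {} \<longrightarrow> e \<in> F)}"
  \<comment> \<open>For \<open>T \<subseteq> V\<close> this is
    \<open>flat_coefficient (induced_complex \<Gamma> T) F\<close>, written with the single edge set
    \<open>E\<close>.\<close>
  define c :: "'a set \<Rightarrow> 'a set set \<Rightarrow> 'k" where
    "c T F = (- 1) ^ card (connected_components (T, F)) *
      of_nat (num_acyclic_orientations (contract (T, {e \<in> E. e \<subseteq> T}) F))" for T F
  have E: "\<forall>e\<in>E. \<exists>x\<in>V. \<exists>y\<in>V. e = {x, y}"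
    using one_skeleton_edge[OF \<Gamma>] unfolding E_def V_def by blast
  have V: "finite V" "V \<noteq> {}"
    using finite_vertices[OF \<Gamma>] ne by (simp_all add: V_def)
  have finE: "finite E"
    using E V(1) finite_subset[of E "Pow V"] by fastforce
  have fin_flats: "finite (flats (W, E'))" if "E' \<subseteq> E" for W E'
    using that finE finite_subset[of "flats (W, E')" "Pow E"] by (auto simp: flats_def)
  have graph: "one_skeleton_graph (induced_complex \<Gamma> T) = (T, {e \<in> E. e \<subseteq> T})"
    "vertices (induced_complex \<Gamma> T) = T" if "T \<subseteq> V" for T
    using that \<Gamma> one_skeleton_graph_induced[OF \<Gamma>, of T]
    by (auto simp: V_def E_def one_skeleton_graph_eq[of \<Gamma>] vertices_induced)
  have "(\<Sum>T\<in>Pow V. flat_expansion (induced_complex \<Gamma> T) * basis_element (induced_complex \<Gamma> (V - T))) =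
    (\<Sum>T\<in>Pow V. \<Sum>F\<in>flats (T, {e \<in> E. e \<subseteq> T}). scale (c T F)
      (basis_element (flat_subcomplex (induced_complex \<Gamma> T) F) * basis_element (induced_complex \<Gamma> (V - T))) ::
      'k complex_algebra)"
    by (rule sum.cong)
       (auto simp: flat_expansion_def flat_coefficient_def graph c_def sum_distrib_right scale_mult_left)
  also have "\<dots> = (\<Sum>(T, F)\<in>Sigma (Pow V) (\<lambda>T. flats (T, {e \<in> E. e \<subseteq> T})). scale (c T F)
      (basis_element (flat_subcomplex (induced_complex \<Gamma> T) F) * basis_element (induced_complex \<Gamma> (V - T))))"
    using V(1) fin_flats by (intro sum.Sigma) auto
  \<comment> \<open>Regroup by the extended flat: \<open>F\<close> is extended by all edges that
    avoid \<open>T\<close>, and restriction to \<open>T\<close> goes back. \<open>?S F\<close>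
    collects the \<open>T\<close> for which \<open>F\<close> arises in this way.\<close>
  also have "\<dots> = (\<Sum>(F, T)\<in>Sigma (flats (V, E)) ?S.
      scale (c T (?r T F)) (basis_element (flat_subcomplex \<Gamma> F)))"
  proof (rule sum.reindex_bij_witness[where i = "\<lambda>(F, T). (T, ?r T F)"
        and j = "\<lambda>(T, F). (F \<union> {e \<in> E. e \<inter> T = {}}, T)"])
    fix p assume "p \<in> Sigma (Pow V) (\<lambda>T. flats (T, {e \<in> E. e \<subseteq> T}))"
    then obtain T F where p: "p = (T, F)" "T \<subseteq> V" "F \<in> flats (T, {e \<in> E. e \<subseteq> T})" by blast
    note ext = flats_extend[OF E p(2,3)]
    show "(case case p of (T, F) \<Rightarrow> (F \<union> {e \<in> E. e \<inter> T = {}}, T) of (F, T) \<Rightarrow> (T, ?r T F)) = p"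
      using ext(3) by (simp add: p)
    show "(case p of (T, F) \<Rightarrow> (F \<union> {e \<in> E. e \<inter> T = {}}, T)) \<in> Sigma (flats (V, E)) ?S"
      using ext p by auto
    have "basis_element (flat_subcomplex (induced_complex \<Gamma> T) (?r T (F \<union> {e \<in> E. e \<inter> T = {}}))) *
        basis_element (induced_complex \<Gamma> (V - T)) =
        (basis_element (flat_subcomplex \<Gamma> (F \<union> {e \<in> E. e \<inter> T = {}})) :: 'k complex_algebra)"
      unfolding V_def by (rule mult_flat_subcomplex[OF \<Gamma> ext(2)]) (auto simp: E_def)
    then show "(case case p of (T, F) \<Rightarrow> (F \<union> {e \<in> E. e \<inter> T = {}}, T) of (F, T) \<Rightarrow>
        scale (c T (?r T F)) (basis_element (flat_subcomplex \<Gamma> F))) =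
      (case p of (T, F) \<Rightarrow> scale (c T F) (basis_element (flat_subcomplex (induced_complex \<Gamma> T) F) *
        basis_element (induced_complex \<Gamma> (V - T))))"
      unfolding p(1) prod.case ext(3) by simp
  next
    fix q assume "q \<in> Sigma (flats (V, E)) ?S"
    then obtain F T where q: "q = (F, T)" "F \<in> flats (V, E)" "T \<subseteq> V" "saturated F T"
      "\<forall>e\<in>E. e \<inter> T = {} \<longrightarrow> e \<in> F" by blast
    have "F \<subseteq> E" using q(2) by (simp add: flats_def)
    then have "?r T F \<union> {e \<in> E. e \<inter> T = {}} = F"
      using q(4,5) unfolding saturated_def by blast
    then show "(case case q of (F, T) \<Rightarrow> (T, ?r T F) of (T, F) \<Rightarrow> (F \<union> {e \<in> E. e \<inter> T = {}}, T)) = q"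
      by (simp add: q(1))
    show "(case q of (F, T) \<Rightarrow> (T, ?r T F)) \<in> Sigma (Pow V) (\<lambda>T. flats (T, {e \<in> E. e \<subseteq> T}))"
      using flats_restrict[OF E q(2,4)] q(3) by (simp add: q(1))
  qed
  also have "\<dots> = (\<Sum>F\<in>flats (V, E). \<Sum>T\<in>?S F. scale (c T (?r T F)) (basis_element (flat_subcomplex \<Gamma> F)))"
    using V(1) fin_flats[of E V] by (intro sum.Sigma[symmetric]) auto
  also have "\<dots> = 0"
  proof (rule sum.neutral, rule ballI)
    fix F assume "F \<in> flats (V, E)"
    then have "F \<subseteq> E" by (simp add: flats_def)
    then have "(\<Sum>T\<in>?S F. c T (?r T F)) = 0"
      unfolding c_def by (rule flat_coefficient_zero[OF E V])
    then show "(\<Sum>T\<in>?S F. scale (c T (?r T F)) (basis_element (flat_subcomplex \<Gamma> F))) =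
        (0 :: 'k complex_algebra)"
      by (simp add: scale.scale_sum_left[symmetric])
  qed
  finally show ?thesis unfolding V_def .
qed

text \<open>The only flat is the empty one; it has no components, and the empty graph has one
  acyclic orientation, so the coefficient is \<open>1\<close>.\<close>

lemma flat_expansion_no_vertices:
  assumes \<Gamma>: "simplicial_complex \<Gamma>" and V: "vertices \<Gamma> = {}"
  shows "flat_expansion \<Gamma> = basis_element \<Gamma>"
proof -
  have eq: "\<Gamma> = {{}}"
    using \<Gamma> V face_subset_vertices[OF \<Gamma>] unfolding simplicial_complex_def by auto
  have graph: "one_skeleton_graph \<Gamma> = ({}, {})"
    using V by (auto simp: one_skeleton_graph_eq eq)
  have "flats ({} :: 'a set, {}) = {{}}" "flat_subcomplex \<Gamma> {} = \<Gamma>"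
    by (auto simp: flats_def connected_components_eq flat_subcomplex_def eq card_2_iff)
  moreover have "num_acyclic_orientations ({} :: 'a set set, {}) = 1"
  proof -
    have "{D \<in> orientations ({} :: 'a set set, {}). acyclic D} = {{}}"
      by (auto simp: orientations_def acyclic_def)
    then show ?thesis by (simp add: num_acyclic_orientations_def)
  qed
  ultimately show ?thesis
    unfolding flat_expansion_def flat_coefficient_def graph V
    by (simp add: contract_eq connected_components_eq)
qed

text \<open>Both sides satisfy the same recursion on the number of vertices. The complex without
  vertices is included as it occurs in the recursion as the term \<open>T = {}\<close>.\<close>

lemma antipode_eq_flat_expansion:
  "simplicial_complex \<Gamma> \<Longrightarrow> (antipode (basis_element \<Gamma>) :: 'k::field complex_algebra) = flat_expansion \<Gamma>"
proof (induction "card (vertices \<Gamma>)" arbitrary: \<Gamma> rule: less_induct)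
  case less
  note \<Gamma> = less.prems
  let ?V = "vertices \<Gamma>"
  let ?rest = "\<lambda>S. \<Sum>T\<in>Pow ?V - {?V}. S T * basis_element (induced_complex \<Gamma> (?V - T)) :: 'k complex_algebra"
  have "convolution antipode id = (unit_map \<circ> counit :: 'k complex_algebra \<Rightarrow> 'k complex_algebra)"
    using is_antipode_antipode[where 'a = 'k] by (simp add: is_antipode_def)
  \<comment> \<open>The term \<open>T = ?V\<close> isolates the antipode of \<open>\<Gamma>\<close>,
    because its second factor is the unit.\<close>
  then have conv: "antipode (basis_element \<Gamma>) + ?rest (\<lambda>T. antipode (basis_element (induced_complex \<Gamma> T))) =
      unit_map (counit (basis_element \<Gamma> :: 'k complex_algebra))"
    using convolution_id_basis_element[OF \<Gamma>, of "antipode :: 'k complex_algebra \<Rightarrow> _"] by simp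
  show ?case
  proof (cases "?V = {}")
    case True
    have "unit_map (1 :: 'k) = basis_element \<Gamma>"
      using basis_element_induced_empty[OF \<Gamma>] induced_vertices[OF \<Gamma>] True
      by (simp add: unit_map_def)
    then show ?thesis
      using conv True by (simp add: counit_basis_element[OF \<Gamma>] flat_expansion_no_vertices[OF \<Gamma>])
  next
    case False
    have IH: "antipode (basis_element (induced_complex \<Gamma> T)) = (flat_expansion (induced_complex \<Gamma> T) :: 'k complex_algebra)"
      if "T \<in> Pow ?V - {?V}" for T
    proof (rule less.hyps)
      show "card (vertices (induced_complex \<Gamma> T)) < card ?V"
        using that finite_vertices[OF \<Gamma>]
        by (simp add: vertices_induced[OF \<Gamma>] psubset_card_mono psubset_eq Int_absorb1)
    qed (rule simplicial_complex_induced[OF \<Gamma>])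
    have "antipode (basis_element \<Gamma>) + ?rest (\<lambda>T. flat_expansion (induced_complex \<Gamma> T)) = 0"
      using conv IH False by (simp add: counit_basis_element[OF \<Gamma>] unit_map_def)
    moreover have "flat_expansion \<Gamma> + ?rest (\<lambda>T. flat_expansion (induced_complex \<Gamma> T)) = 0"
      using sum_flat_expansion_mult[OF \<Gamma> False, where 'k = 'k] finite_vertices[OF \<Gamma>]
      by (subst (asm) sum.remove[of _ ?V])
         (simp_all add: induced_vertices[OF \<Gamma>] basis_element_induced_empty[OF \<Gamma>])
    ultimately have "antipode (basis_element \<Gamma>) + ?rest (\<lambda>T. flat_expansion (induced_complex \<Gamma> T)) =
      flat_expansion \<Gamma> + ?rest (\<lambda>T. flat_expansion (induced_complex \<Gamma> T))"
      by (rule trans[OF _ sym])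
    then show ?thesis by (rule add_right_imp_eq)
  qed
qed

theorem theorem3p1:
  fixes \<Gamma> :: "'a set set" and n :: nat
  assumes "simplicial_complex \<Gamma>"
    and "card (vertices \<Gamma>) = n" and "n \<ge> 1"
  shows "(antipode (basis_element \<Gamma>) :: 'k::field complex_algebra) =
    (\<Sum>F \<in> flats (one_skeleton_graph \<Gamma>).
       scale ((- 1) ^ card (connected_components (vertices \<Gamma>, F))
              * of_nat (num_acyclic_orientations (contract (one_skeleton_graph \<Gamma>) F)))
         (basis_element (flat_subcomplex \<Gamma> F)))"
  using antipode_eq_flat_expansion[OF assms(1), where 'k = 'k]
  unfolding flat_expansion_def flat_coefficient_def .

end
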